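(* Let $\mathcal A$ be a linear transformation of a finite-dimensional complex vector space $V$ with non-trivial kernel $K=\ker\mathcal A$, $0<\dim K<\dim V$. The Jordan structure $\tilde{\mathcal J}$ of $\tilde{\mathcal A}:=\pi\mathcal A\in\operatorname{End}(V/K)$ is defined by the Jordan structure $\mathcal J$ of $\mathcal A$, namely: \begin{itemize} \item the Jordan chains corresponding to the non-zero eigenvalues for $\mathcal J$ and for $\tilde{\mathcal J}$ coincide (the same non-zero eigenvalues, with the same numbers and lengths of chains); \item the Jordan chains corresponding to the zero eigenvalue of $\tilde{\mathcal J}$ are in one-to-one correspondence with those chains of $\mathcal J$ for the zero eigenvalue that have non-unit length, and the chains of $\tilde{\mathcal J}$ are one unit shorter than the corresponding chains of $\mathcal J$; \item the chains of $\mathcal J$ for the zero eigenvalue of unit length (without generalized eigenvectors) form the kernel of the projection of the set of Jordan chains of $\mathcal J$ to the set of Jordan chains of $\tilde{\mathcal J}$, i.e. they have no counterpart in $\tilde{\mathcal J}$. \end{itemize}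
   Context: The Jordan structure of a linear transformation is the set of its eigenvalues together with, for each eigenvalue, the number of Jordan chains and their lengths. Let $\operatorname{Pr}^{\parallel K}:V\to V/K$ be the quotient map. Since $K=\ker\mathcal A$, there is a unique $\tilde{\tilde{\mathcal A}}\in\operatorname{Hom}(V/K,V)$ with $\mathcal A=\tilde{\tilde{\mathcal A}}\circ\operatorname{Pr}^{\parallel K}$. Define $\pi\mathcal A:=\operatorname{Pr}^{\parallel K}\circ\tilde{\tilde{\mathcal A}}\in\operatorname{End}(V/K)$, i.e. $\pi\mathcal A$ is the transformation of $V/K$ induced by $\mathcal A$. *)

theory Defs
  imports "HOL-Algebra.AbelCoset" "Jordan_Normal_Form.VS_Connect"
begin

section \<open>Quotient space and induced transformation\<close>

text \<open>
  Records of type \<open>module\<close> extend \<open>ring\<close>; the fields \<open>mult\<close> and \<open>one\<close> are not used by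
  the locale \<open>vectorspace\<close> and get dummy values. In the scalar multiplication, the union over
  the representatives \<open>x\<close> of \<open>X\<close> is a union of equal cosets.
\<close>

definition quotient_space :: "(complex, 'v) module \<Rightarrow> 'v set \<Rightarrow> (complex, 'v set) module" where
  "quotient_space V K =
     \<lparr> carrier = a_rcosets\<^bsub>V\<^esub> K,
       mult = (\<lambda>X Y. K),
       one = K,
       zero = K,
       add = (\<lambda>X Y. X <+>\<^bsub>V\<^esub> Y),
       smult = (\<lambda>a X. \<Union>x\<in>X. K +>\<^bsub>V\<^esub> (a \<odot>\<^bsub>V\<^esub> x)) \<rparr>"

definition quotient_map :: "(complex, 'v) module \<Rightarrow> 'v set \<Rightarrow> 'v \<Rightarrow> 'v set" where
  "quotient_map V K v = K +>\<^bsub>V\<^esub> v"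

text \<open>
  The map \<open>V/K \<rightarrow> V\<close> through which a linear \<open>A\<close> with kernel \<open>K\<close> factors: \<open>A\<close> is constant on
  each coset \<open>X\<close> of \<open>K\<close>, so \<open>A ` X\<close> is a singleton.
\<close>

definition factor_map :: "('v \<Rightarrow> 'v) \<Rightarrow> 'v set \<Rightarrow> 'v" where
  "factor_map A X = the_elem (A ` X)"

definition induced_map :: "(complex, 'v) module \<Rightarrow> ('v \<Rightarrow> 'v) \<Rightarrow> 'v set \<Rightarrow> 'v set" where
  "induced_map V A = quotient_map V (mod_hom.ker V V A) \<circ> factor_map A"

section \<open>Jordan structure\<close>

definition lin_eigenvalues :: "(complex, 'v) module \<Rightarrow> ('v \<Rightarrow> 'v) \<Rightarrow> complex set" where
  "lin_eigenvalues V A =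
     {l. \<exists>v\<in>carrier V. v \<noteq> \<zero>\<^bsub>V\<^esub> \<and> A v = l \<odot>\<^bsub>V\<^esub> v}"

text \<open>A chain starts with its eigenvector, followed by the generalized eigenvectors.\<close>

definition jordan_chain ::
    "(complex, 'v) module \<Rightarrow> ('v \<Rightarrow> 'v) \<Rightarrow> complex \<Rightarrow> 'v list \<Rightarrow> bool" where
  "jordan_chain V A l vs \<longleftrightarrow>
     vs \<noteq> [] \<and> set vs \<subseteq> carrier V \<and> vs ! 0 \<noteq> \<zero>\<^bsub>V\<^esub> \<and>
     A (vs ! 0) = l \<odot>\<^bsub>V\<^esub> (vs ! 0) \<and>
     (\<forall>i. Suc i < length vs \<longrightarrow>
        A (vs ! Suc i) = (l \<odot>\<^bsub>V\<^esub> (vs ! Suc i)) \<oplus>\<^bsub>V\<^esub> (vs ! i))"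

definition jordan_basis ::
    "(complex, 'v) module \<Rightarrow> ('v \<Rightarrow> 'v) \<Rightarrow> (complex \<times> 'v list) set \<Rightarrow> bool" where
  "jordan_basis V A C \<longleftrightarrow>
     finite C \<and>
     (\<forall>(l, vs)\<in>C. jordan_chain V A l vs \<and> distinct vs) \<and>
     (\<forall>c\<in>C. \<forall>d\<in>C. c \<noteq> d \<longrightarrow> set (snd c) \<inter> set (snd d) = {}) \<and>
     vectorspace.basis class_ring V (\<Union>c\<in>C. set (snd c))"

text \<open>
  The multiset \<open>chain_lengths J l\<close> contains the lengths of the chains for \<open>l\<close>, one entry per
  chain, so its size is the number of chains.
\<close>

record jordan_structure =
  eigenvalues :: "complex set"
  chain_lengths :: "complex \<Rightarrow> nat multiset"

definition is_jordan_structure ::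
    "(complex, 'v) module \<Rightarrow> ('v \<Rightarrow> 'v) \<Rightarrow> jordan_structure \<Rightarrow> bool" where
  "is_jordan_structure V A J \<longleftrightarrow>
     eigenvalues J = lin_eigenvalues V A \<and>
     (\<exists>C. jordan_basis V A C \<and>
        (\<forall>l. chain_lengths J l =
           image_mset (\<lambda>(_, vs). length vs) (mset_set {c \<in> C. fst c = l})))"

definition jordan_structure_of ::
    "(complex, 'v) module \<Rightarrow> ('v \<Rightarrow> 'v) \<Rightarrow> jordan_structure" where
  "jordan_structure_of V A = (THE J. is_jordan_structure V A J)"

text \<open>
  The set of chains of a Jordan structure: \<open>(l, n, i)\<close> is the chain number \<open>i\<close> among those of
  length \<open>n\<close> for the eigenvalue \<open>l\<close>. The number \<open>i\<close> only serves to keep chains with equal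
  eigenvalue and length apart.
\<close>

definition chain_set :: "jordan_structure \<Rightarrow> (complex \<times> nat \<times> nat) set" where
  "chain_set J = {(l, n, i). l \<in> eigenvalues J \<and> i < count (chain_lengths J l) n}"

end

theory Submission
  imports Defs "HOL-Library.Function_Algebras" "HOL-Computational_Algebra.Fundamental_Theorem_Algebra"
begin

text \<open>
  Everything rests on one operation. Let \<open>U\<close> have a Jordan basis for \<open>f\<close>, and drop the last vector
  of every chain with eigenvalue \<open>m\<close>. The remaining vectors form a Jordan basis of
  \<open>(f - m) ` U\<close>: the chains for \<open>m\<close> are shifted by \<open>f - m\<close>, and \<open>f - m\<close> is onto on the span of every
  other chain. Hence the number of chains for \<open>m\<close> is \<open>dim U - dim ((f - m) ` U)\<close>, and induction
  on the dimension gives uniqueness of the chain lengths. Existence reverses the operation: prolong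
  the chains for \<open>m\<close> of a Jordan basis of \<open>(f - m) ` U\<close> and complete their heads to a basis of the
  kernel of \<open>f - m\<close>.

  Since \<open>A\<close> induces an isomorphism (\<open>factor_map A\<close>) of \<open>V/K\<close> with the image of \<open>A\<close>, which turns \<open>\<pi>A\<close> into the
  restriction of \<open>A\<close>, the case \<open>m = 0\<close> of the same operation is the theorem. Vectors are
  transferred by coordinates to the type \<open>'v \<Rightarrow> complex\<close>, where the type class based linear
  algebra is available.
\<close>

section \<open>Dimension counts relative to a finite independent or spanning set\<close>

context vector_space
begin

text \<open>By exchange, a finite set whose span contains \<open>U\<close> has at least
  \<open>card B\<close> elements. A repeated entry or a redundant vector in \<open>xs\<close> would
  yield a smaller one. So a Jordan basis can be recognized by spanning and counting alone.\<close>

lemma distinct_independent_if_spanning_list: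
  assumes B: "finite B" "independent B" "B \<subseteq> U"
    and xs: "U \<subseteq> span (set xs)" "length xs \<le> card B"
  shows "distinct xs \<and> independent (set xs)"
proof -
  have card_B: "card B \<le> card T" if "finite T" "U \<subseteq> span T" for T
    using independent_span_bound[of T B] that B by auto
  have "card (set xs) = length xs"
    using card_B[of "set xs"] xs card_length[of xs] by simp
  then have d: "distinct xs" by (rule card_distinct)
  have "independent (set xs)"
  proof
    assume "dependent (set xs)"
    then obtain a where a: "a \<in> set xs" "a \<in> span (set xs - {a})"
      unfolding dependent_def by auto
    have "span (set xs - {a}) = span (set xs)"
      using span_redundant[OF a(2)] a(1) by (simp add: insert_absorb)
    then have "card B \<le> card (set xs - {a})"
      using card_B[of "set xs - {a}"] xs by simp
    also have "\<dots> < card (set xs)" by (rule card_Diff1_less) (use a in auto)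
    also have "\<dots> \<le> card B" using xs(2) card_length[of xs] by simp
    finally show False by simp
  qed
  with d show ?thesis by simp
qed

lemma card_kernel_plus_card_image_le:
  assumes g: "Vector_Spaces.linear scale scale g"
    and U: "subspace U" "U \<subseteq> span B" "finite B"
    and N: "independent N" "N \<subseteq> U" "\<And>x. x \<in> N \<Longrightarrow> g x = 0"
    and M: "independent M" "M \<subseteq> g ` U"
  shows "finite N \<and> finite M \<and> card N + card M \<le> card B"
proof -
  interpret p: vector_space_pair scale scale by unfold_locales
  interpret g: Vector_Spaces.linear scale scale g by fact
  obtain h where h: "range h \<subseteq> U" "\<forall>v\<in>g ` U. g (h v) = v"
    using p.linear_exists_right_inverse_on[OF g U(1)] by metis
  have finN: "finite N" using independent_span_bound[OF U(3) N(1)] N U by auto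
  have "g ` U \<subseteq> span (g ` B)" using U by (simp add: p.linear_spans_image[OF g])
  then have finM: "finite M"
    using independent_span_bound[of "g ` B" M] U M by auto
  have gh: "g (h w) = w" if "w \<in> M" for w using h M that by auto
  have inj: "inj_on h M" by (metis gh inj_onI)
  have "0 \<notin> M" using M(1) dependent_zero by blast
  then have disj: "N \<inter> h ` M = {}" using gh N(3) by fastforce
  have ind: "independent (N \<union> h ` M)"
    unfolding dependent_finite[OF finite_UnI[OF finN finite_imageI[OF finM]]]
  proof clarify
    fix u v assume v: "v \<in> N \<union> h ` M" "u v \<noteq> 0"
      and s: "(\<Sum>v\<in>N \<union> h ` M. scale (u v) v) = 0"
    have split: "(\<Sum>v\<in>N. scale (u v) v) + (\<Sum>w\<in>M. scale (u (h w)) (h w)) = 0"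
      using s sum.union_disjoint[OF finN finite_imageI[OF finM] disj, of "\<lambda>v. scale (u v) v"]
      by (simp add: sum.reindex[OF inj])
    have "g ((\<Sum>v\<in>N. scale (u v) v) + (\<Sum>w\<in>M. scale (u (h w)) (h w))) = (\<Sum>w\<in>M. scale (u (h w)) w)"
      by (simp add: g.add g.sum g.scale N(3) gh)
    then have "(\<Sum>w\<in>M. scale (u (h w)) w) = 0" by (simp add: split g.zero)
    then have M0: "u (h w) = 0" if "w \<in> M" for w
      using independentD[OF M(1) finM order.refl, of "u \<circ> h"] that by simp
    then have "(\<Sum>v\<in>N. scale (u v) v) = 0" using split by simp
    then have N0: "u w = 0" if "w \<in> N" for w
      using independentD[OF N(1) finN order.refl] that by simp
    show False using v M0 N0 by auto
  qed
  have "h ` M \<subseteq> U" using h(1) by auto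
  then have "N \<union> h ` M \<subseteq> span B" using N(2) U(2) by auto
  from independent_span_bound[OF U(3) ind this]
  show ?thesis
    using finN finM disj by (simp add: card_Un_disjoint card_image[OF inj])
qed

end

section \<open>Jordan bases as lists of chains\<close>

text \<open>Decreasing all entries and discarding zeros loses exactly the ones, and the size tells
  how many were lost: put that many zeros back and apply \<open>Suc\<close>. This is the
  combinatorial step in the uniqueness of chain lengths.\<close>

lemma multiset_eq_if_pred_eq:
  assumes "size M = size N" "0 \<notin># M" "0 \<notin># N"
    and "filter_mset (\<lambda>n. n \<noteq> 0) (image_mset (\<lambda>n. n - 1) M) =
         filter_mset (\<lambda>n. n \<noteq> 0) (image_mset (\<lambda>n::nat. n - 1) N)"
  shows "M = N"
proof -
  let ?p = "\<lambda>n::nat. n - 1"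
  have rec: "M = image_mset Suc (filter_mset (\<lambda>n. n \<noteq> 0) (image_mset ?p M)
      + replicate_mset (size M - size (filter_mset (\<lambda>n. n \<noteq> 0) (image_mset ?p M))) 0)"
    if "0 \<notin># M" for M
  proof -
    let ?F = "filter_mset (\<lambda>n. n \<noteq> 0) (image_mset ?p M)"
    have part: "image_mset ?p M = ?F + filter_mset (\<lambda>n. n = 0) (image_mset ?p M)"
      using multiset_partition[of "image_mset ?p M" "\<lambda>n. n \<noteq> 0"] by simp
    have "size (filter_mset (\<lambda>n. n = 0) (image_mset ?p M)) = size M - size ?F"
      using arg_cong[OF part, of size] unfolding size_union size_image_mset by linarith
    then have "filter_mset (\<lambda>n. n = 0) (image_mset ?p M) = replicate_mset (size M - size ?F) 0"
      by (metis filter_eq_replicate_mset size_replicate_mset)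
    moreover have "image_mset Suc (image_mset ?p M) = M"
    proof -
      have "image_mset (\<lambda>n. Suc (n - 1)) M = image_mset (\<lambda>n. n) M"
        using that by (intro image_mset_cong) (metis Suc_pred' neq0_conv)
      then show ?thesis by (simp add: image_mset.compositionality comp_def)
    qed
    ultimately show ?thesis using part by metis
  qed
  show ?thesis
    by (subst rec[OF assms(2)], subst rec[OF assms(3)]) (simp only: assms(1,4))
qed

section \<open>The maps \<open>f - l\<close> and their chains\<close>

locale vector_space_endo = vector_space scale
  for scale :: "complex \<Rightarrow> 'b::ab_group_add \<Rightarrow> 'b" (infixr \<open>*s\<close> 75) +
  fixes f :: "'b \<Rightarrow> 'b"
  assumes linear_f: "Vector_Spaces.linear scale scale f"
begin

sublocale f: Vector_Spaces.linear scale scale f by (rule linear_f)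

definition shift :: "complex \<Rightarrow> 'b \<Rightarrow> 'b" where
  "shift l v = f v - l *s v"

lemma shift_0: "shift 0 = f"
  by (simp add: shift_def fun_eq_iff)

lemma linear_shift: "Vector_Spaces.linear scale scale (shift l)"
  by unfold_locales (simp_all add: shift_def f.add f.scale algebra_simps scale_right_distrib scale_right_diff_distrib)

sublocale shift: Vector_Spaces.linear scale scale "shift l" for l by (rule linear_shift)

lemma f_shift_commute: "f (shift l v) = shift l (f v)"
  by (simp add: shift_def f.diff f.scale)

lemma shift_change: "shift m v = shift l v + (l - m) *s v"
  by (simp add: shift_def scale_left_diff_distrib)

definition chain :: "complex \<Rightarrow> 'b list \<Rightarrow> bool" where
  "chain l vs \<longleftrightarrow> (\<forall>i<length vs. shift l (vs ! i) = (if i = 0 then 0 else vs ! (i - 1)))"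

lemma chain_butlast: "chain l vs \<Longrightarrow> chain l (butlast vs)"
  by (auto simp: chain_def nth_butlast)

lemma chain_snoc:
  assumes "chain l vs" "vs \<noteq> []" "shift l w = last vs"
  shows "chain l (vs @ [w])"
  using assms by (auto simp: chain_def nth_append last_conv_nth less_Suc_eq)

text \<open>\<open>shift m\<close> differs from \<open>shift l\<close> by a scalar, and
  \<open>shift l\<close> moves each entry to its predecessor, or to 0 at the head.\<close>

lemma shift_chain_subset_span:
  assumes "chain l vs"
  shows "shift m ` span (set vs) \<subseteq> span (set vs)"
proof -
  have "shift m (vs ! i) \<in> span (set vs)" if "i < length vs" for i
  proof -
    have "shift l (vs ! i) = (if i = 0 then 0 else vs ! (i - 1))"
      using assms that by (simp add: chain_def)
    then have "shift l (vs ! i) \<in> span (set vs)"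
      using that by (auto simp: span_zero intro!: span_base nth_mem)
    then show ?thesis
      unfolding shift_change[of m _ l]
      using that by (meson nth_mem span_add span_base span_scale)
  qed
  then have "shift m ` set vs \<subseteq> span (set vs)" by (auto simp: in_set_conv_nth)
  then show ?thesis
    unfolding shift.span_image[symmetric] by (intro span_minimal) auto
qed

text \<open>Here \<open>shift m (vs ! i)\<close> is \<open>l - m\<close> times
  \<open>vs ! i\<close>, plus the preceding entry if there is one. As \<open>l - m\<close> is
  invertible, this can be solved for \<open>vs ! i\<close> by induction along the chain.\<close>

lemma span_chain_subset_shift:
  assumes c: "chain l vs" and ml: "m \<noteq> l"
  shows "span (set vs) \<subseteq> shift m ` span (set vs)"
proof -
  let ?W = "shift m ` span (set vs)"
  have W: "subspace ?W" by (intro shift.subspace_image) auto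
  have "vs ! i \<in> ?W" if "i < length vs" for i
    using that
  proof (induction i)
    case 0
    have "(l - m) *s (vs ! 0) = shift m (vs ! 0)"
      using c 0 shift_change[of m "vs ! 0" l] by (simp add: chain_def)
    then have "vs ! 0 = inverse (l - m) *s shift m (vs ! 0)"
      by (metis ml eq_iff_diff_eq_0 left_inverse scale_one scale_scale)
    then show ?case
      by (metis "0" W imageI nth_mem span_base subspace_scale)
  next
    case (Suc i)
    have "(l - m) *s (vs ! Suc i) = shift m (vs ! Suc i) - vs ! i"
      using c Suc.prems shift_change[of m "vs ! Suc i" l] by (simp add: chain_def)
    then have "vs ! Suc i = inverse (l - m) *s (shift m (vs ! Suc i) - vs ! i)"
      by (metis ml eq_iff_diff_eq_0 left_inverse scale_one scale_scale)
    moreover have "shift m (vs ! Suc i) - vs ! i \<in> ?W"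
      using Suc.prems by (intro subspace_diff[OF W] imageI span_base Suc.IH) auto
    ultimately show ?case using W by (metis subspace_scale)
  qed
  then have "set vs \<subseteq> ?W" by (auto simp: in_set_conv_nth)
  then show ?thesis using W by (rule span_minimal)
qed

text \<open>Keeping the chains in a list makes disjointness and distinctness of the chains a single
  condition on their concatenation.\<close>

definition chains_basis :: "'b set \<Rightarrow> (complex \<times> 'b list) list \<Rightarrow> bool" where
  "chains_basis U cs \<longleftrightarrow>
     (\<forall>c\<in>set cs. snd c \<noteq> [] \<and> chain (fst c) (snd c)) \<and>
     distinct (concat (map snd cs)) \<and>
     independent (set (concat (map snd cs))) \<and>
     span (set (concat (map snd cs))) = U"

section \<open>Dropping the last vector of every chain for one eigenvalue\<close>

definition lengths :: "complex \<Rightarrow> (complex \<times> 'b list) list \<Rightarrow> nat multiset" where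
  "lengths l cs = image_mset (length \<circ> snd) (filter_mset (\<lambda>c. fst c = l) (mset cs))"

text \<open>The filter removes the chains for \<open>m\<close> of length one, which become empty.
  For \<open>m = 0\<close> these are the chains without counterpart in the quotient.\<close>

definition shorten :: "complex \<Rightarrow> (complex \<times> 'b list) list \<Rightarrow> (complex \<times> 'b list) list" where
  "shorten m cs = filter (\<lambda>c. snd c \<noteq> [])
     (map (\<lambda>c. (fst c, if fst c = m then butlast (snd c) else snd c)) cs)"

lemma dim_chains_basis:
  assumes "chains_basis U cs"
  shows "dim U = length (concat (map snd cs))"
proof -
  have "dim (span (set (concat (map snd cs)))) = card (set (concat (map snd cs)))"
    using assms unfolding chains_basis_def by (intro dim_span_eq_card_independent) blast
  also have "\<dots> = length (concat (map snd cs))"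
    using assms unfolding chains_basis_def by (intro distinct_card) blast
  finally show ?thesis using assms unfolding chains_basis_def by metis
qed

lemma lengths_Cons:
  "lengths l (c # cs) = (if fst c = l then {#length (snd c)#} else {#}) + lengths l cs"
  by (simp add: lengths_def)

lemma shorten_Cons:
  "shorten m (c # cs) =
     (if (if fst c = m then butlast (snd c) else snd c) = [] then []
      else [(fst c, if fst c = m then butlast (snd c) else snd c)]) @ shorten m cs"
  by (simp add: shorten_def)

lemma in_set_shorten_iff:
  "(l, ws) \<in> set (shorten m cs) \<longleftrightarrow>
     (\<exists>vs. (l, vs) \<in> set cs \<and> ws = (if l = m then butlast vs else vs)) \<and> ws \<noteq> []"
  by (force simp: shorten_def)

lemma set_concat_shorten_subset:
  "set (concat (map snd (shorten m cs))) \<subseteq> set (concat (map snd cs))"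
proof
  fix v assume "v \<in> set (concat (map snd (shorten m cs)))"
  then obtain l vs where "(l, vs) \<in> set cs" "v \<in> set (if l = m then butlast vs else vs)"
    by (auto simp: in_set_shorten_iff)
  then have "(l, vs) \<in> set cs" "v \<in> set vs" by (auto split: if_splits dest: in_set_butlastD)
  then show "v \<in> set (concat (map snd cs))" by force
qed

lemma distinct_concat_shorten:
  "distinct (concat (map snd cs)) \<Longrightarrow> distinct (concat (map snd (shorten m cs)))"
proof (induction cs)
  case (Cons c cs)
  have "set (concat (map snd (shorten m cs))) \<subseteq> set (concat (map snd cs))"
    by (rule set_concat_shorten_subset)
  then have "set (snd c) \<inter> set (concat (map snd (shorten m cs))) = {}"
    using Cons.prems by auto
  moreover have "distinct (concat (map snd (shorten m cs)))"
    using Cons by simp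
  moreover have "set (butlast (snd c)) \<subseteq> set (snd c)" by (auto dest: in_set_butlastD)
  ultimately show ?case
    using Cons.prems by (auto simp: shorten_def distinct_butlast)
qed (simp add: shorten_def)

text \<open>The kept vectors form a subfamily of the old basis, so distinctness and independence are
  inherited. Only the span has to be computed, by checking generators for both inclusions.\<close>

lemma chains_basis_shorten:
  assumes J: "chains_basis U cs"
  shows "chains_basis (shift m ` U) (shorten m cs)"
proof -
  let ?L = "set (concat (map snd cs))" and ?M = "set (concat (map snd (shorten m cs)))"
  have ch: "chain l vs" "vs \<noteq> []" if "(l, vs) \<in> set cs" for l vs
    using J that by (force simp: chains_basis_def)+
  have U: "U = span ?L" using J by (simp add: chains_basis_def)
  have sub: "subspace (shift m ` U)" unfolding U by (intro shift.subspace_image) auto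
  have L: "set vs \<subseteq> ?L" if "(l, vs) \<in> set cs" for l vs
    using that by force
  have M: "set vs \<subseteq> ?M" if "(l, vs) \<in> set cs" "l \<noteq> m" for l vs
    using that by (force simp: shorten_def)
  have Mb: "set (butlast vs) \<subseteq> ?M" if "(m, vs) \<in> set cs" for vs
    using that by (force simp: shorten_def)
  \<comment> \<open>A kept vector of a chain for \<open>m\<close> is the image of its successor. On
    the span of any other chain \<open>shift m\<close> is onto.\<close>
  have "v \<in> shift m ` U" if v: "v \<in> ?M" for v
  proof -
    obtain l vs where lvs: "(l, vs) \<in> set cs" "v \<in> set (if l = m then butlast vs else vs)"
      using v by (auto simp: in_set_shorten_iff)
    show ?thesis
    proof (cases "l = m")
      case True
      then obtain i where i: "i < length (butlast vs)" "v = butlast vs ! i"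
        using lvs by (auto simp: in_set_conv_nth)
      then have "v = shift m (vs ! Suc i)"
        using ch[OF lvs(1)] True by (auto simp: chain_def nth_butlast)
      moreover have "vs ! Suc i \<in> U"
        unfolding U using i by (intro span_base subsetD[OF L[OF lvs(1)]]) auto
      ultimately show ?thesis by auto
    next
      case False
      then have "v \<in> shift m ` span (set vs)"
        using lvs span_chain_subset_shift[OF ch(1)[OF lvs(1)], of m] by (auto intro: span_base)
      then show ?thesis using span_mono[OF L[OF lvs(1)]] U by auto
    qed
  qed
  \<comment> \<open>In a chain for \<open>m\<close> the head goes to 0 and every other vector to its
    predecessor, which is kept because it is not the last. Other chains are kept whole and have an
    invariant span.\<close>
  moreover have "shift m v \<in> span ?M" if v: "v \<in> ?L" for v
  proof -
    obtain l vs where lvs: "(l, vs) \<in> set cs" "v \<in> set vs" using v by force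
    show ?thesis
    proof (cases "l = m")
      case True
      obtain i where i: "i < length vs" "v = vs ! i" using lvs by (auto simp: in_set_conv_nth)
      show ?thesis
      proof (cases i)
        case 0
        then show ?thesis using i True ch[OF lvs(1)] by (simp add: chain_def span_zero)
      next
        case (Suc j)
        then have "shift m v = butlast vs ! j" "j < length (butlast vs)"
          using i True ch[OF lvs(1)] by (auto simp: chain_def nth_butlast)
        then have "shift m v \<in> ?M" using Mb lvs True by (metis nth_mem subsetD)
        then show ?thesis by (rule span_base)
      qed
    next
      case False
      have "shift m v \<in> span (set vs)"
        using shift_chain_subset_span[OF ch(1)[OF lvs(1)], of m] lvs(2) by (auto intro: span_base)
      then show ?thesis using span_mono[OF M[OF lvs(1) False]] by auto
    qed
  qed
  ultimately have "span ?M = shift m ` U"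
    unfolding U shift.span_image[symmetric]
    by (intro subset_antisym span_minimal subspace_span) auto
  moreover have "independent ?M"
    using J independent_mono set_concat_shorten_subset unfolding chains_basis_def by blast
  moreover have "\<forall>c\<in>set (shorten m cs). snd c \<noteq> [] \<and> chain (fst c) (snd c)"
    using ch by (auto simp: shorten_def chain_butlast)
  ultimately show ?thesis
    using J distinct_concat_shorten unfolding chains_basis_def by metis
qed

text \<open>Truncated subtraction matches \<open>butlast\<close> on empty chains too, and the filter
  on lengths mirrors the removal of empty chains in \<open>shorten\<close>.\<close>

lemma lengths_shorten:
  "lengths l (shorten m cs) =
     (if l = m then filter_mset (\<lambda>n. n \<noteq> 0) (image_mset (\<lambda>n. n - 1) (lengths l cs))
      else filter_mset (\<lambda>n. n \<noteq> 0) (lengths l cs))"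
proof (induction cs)
  case (Cons c cs)
  have "butlast (snd c) = [] \<longleftrightarrow> length (snd c) - 1 = 0"
    by (metis length_0_conv length_butlast)
  then show ?case using Cons.IH
    by (cases "fst c = m"; cases "fst c = l"; cases "snd c = []"; cases "butlast (snd c) = []")
      (simp_all add: lengths_Cons shorten_Cons)
qed (simp add: lengths_def shorten_def)

lemma zero_notin_lengths: "chains_basis U cs \<Longrightarrow> 0 \<notin># lengths l cs"
  by (auto simp: lengths_def chains_basis_def)

lemma lengths_shorten_other:
  assumes "chains_basis U cs" "l \<noteq> m"
  shows "lengths l (shorten m cs) = lengths l cs"
proof -
  have "filter_mset (\<lambda>n. n \<noteq> 0) (lengths l cs) = lengths l cs"
    using zero_notin_lengths[OF assms(1), of l] by (simp add: filter_mset_eq_conv) (metis neq0_conv)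
  with assms(2) show ?thesis by (simp add: lengths_shorten)
qed

text \<open>Each nonempty chain for \<open>m\<close> loses exactly one vector, so the loss counts
  these chains.\<close>

lemma length_concat_shorten:
  assumes "\<forall>c\<in>set cs. snd c \<noteq> []"
  shows "length (concat (map snd (shorten m cs))) + size (lengths m cs) =
    length (concat (map snd cs))"
  using assms
proof (induction cs)
  case (Cons c cs)
  then have "snd c \<noteq> []" by simp
  then have "length (butlast (snd c)) + 1 = length (snd c)" by simp
  moreover have "length (concat (map snd (shorten m cs))) + size (lengths m cs) =
    length (concat (map snd cs))"
    using Cons by simp
  moreover have "length (concat (map snd (shorten m (c # cs)))) =
      length (if fst c = m then butlast (snd c) else snd c) + length (concat (map snd (shorten m cs)))"
    by (simp add: shorten_Cons del: length_butlast)
  ultimately show ?case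
    by (cases "fst c = m") (simp_all add: lengths_Cons del: length_butlast length_concat)
qed (simp add: lengths_def shorten_def)

section \<open>Uniqueness of the chain lengths and their relation to eigenvalues\<close>

lemma dim_shift_image:
  assumes "chains_basis U cs"
  shows "dim (shift m ` U) + size (lengths m cs) = dim U"
  using dim_chains_basis[OF assms] dim_chains_basis[OF chains_basis_shorten[OF assms]]
    length_concat_shorten[of cs m] assms
  by (simp add: chains_basis_def)

lemma lengths_unique:
  "chains_basis U cs \<Longrightarrow> chains_basis U ds \<Longrightarrow> lengths l cs = lengths l ds"
proof (induction "dim U" arbitrary: U cs ds rule: less_induct)
  case less
  note c = \<open>chains_basis U cs\<close> and d = \<open>chains_basis U ds\<close>
  have size: "size (lengths l cs) = size (lengths l ds)"
    using dim_shift_image[OF c, of l] dim_shift_image[OF d, of l] by simp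
  show ?case
  proof (cases "size (lengths l cs) = 0")
    case True
    then show ?thesis using size by auto
  next
    case False
    then have "dim (shift l ` U) < dim U" using dim_shift_image[OF c, of l] by linarith
    from less.hyps[OF this chains_basis_shorten[OF c] chains_basis_shorten[OF d]]
    show ?thesis
      using multiset_eq_if_pred_eq[OF size zero_notin_lengths[OF c] zero_notin_lengths[OF d]]
      by (simp add: lengths_shorten)
  qed
qed

text \<open>The head of a chain is an eigenvector. Conversely, an eigenvector makes the rank of
  \<open>shift l\<close> drop by at least one, so shortening must lose a vector.\<close>

lemma eigenvalue_iff_lengths:
  assumes J: "chains_basis U cs"
  shows "(\<exists>v\<in>U. v \<noteq> 0 \<and> f v = l *s v) \<longleftrightarrow> lengths l cs \<noteq> {#}"
proof
  assume "lengths l cs \<noteq> {#}"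
  then obtain vs where vs: "(l, vs) \<in> set cs" by (auto simp: lengths_def filter_mset_eq_conv)
  then have c: "vs \<noteq> []" "chain l vs" using J by (force simp: chains_basis_def)+
  have mem: "vs ! 0 \<in> set (concat (map snd cs))" using vs c by force
  then have "vs ! 0 \<noteq> 0" using J dependent_zero unfolding chains_basis_def by metis
  moreover have "f (vs ! 0) = l *s (vs ! 0)" using c by (auto simp: chain_def shift_def)
  moreover have "vs ! 0 \<in> U" using J mem by (auto simp: chains_basis_def intro: span_base)
  ultimately show "\<exists>v\<in>U. v \<noteq> 0 \<and> f v = l *s v" by blast
next
  assume "\<exists>v\<in>U. v \<noteq> 0 \<and> f v = l *s v"
  then obtain v where v: "v \<in> U" "v \<noteq> 0" "shift l v = 0" by (auto simp: shift_def)
  let ?M = "set (concat (map snd (shorten l cs)))"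
  have U: "span (set (concat (map snd cs))) = U" and d: "distinct (concat (map snd cs))"
    using J by (auto simp: chains_basis_def)
  have S: "independent ?M" "?M \<subseteq> shift l ` U" "distinct (concat (map snd (shorten l cs)))"
    using chains_basis_shorten[OF J, of l] span_superset[of ?M] unfolding chains_basis_def by metis+
  have "card {v} + card ?M \<le> card (set (concat (map snd cs)))"
    using card_kernel_plus_card_image_le[OF linear_shift[of l], of U
        "set (concat (map snd cs))" "{v}" ?M] v U S subspace_span by auto
  then have "1 + length (concat (map snd (shorten l cs))) \<le> length (concat (map snd cs))"
    unfolding distinct_card[OF d] distinct_card[OF S(3)] by simp
  moreover have "\<forall>c\<in>set cs. snd c \<noteq> []" using J by (simp add: chains_basis_def)
  note length_concat_shorten[OF this, of l]
  ultimately have "size (lengths l cs) \<ge> 1" by linarith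
  then show "lengths l cs \<noteq> {#}" by auto
qed

end

section \<open>Existence of a Jordan basis\<close>

context vector_space_endo
begin

text \<open>This is p(f) v, evaluated by Horner's scheme.\<close>

definition poly_endo :: "complex poly \<Rightarrow> 'b \<Rightarrow> 'b" where
  "poly_endo p v = fold_coeffs (\<lambda>a w. a *s v + f w) p 0"

lemma poly_endo_0: "poly_endo 0 v = 0"
  by (simp add: poly_endo_def)

lemma poly_endo_pCons: "poly_endo (pCons a p) v = a *s v + f (poly_endo p v)"
  by (cases "p = 0 \<and> a = 0") (auto simp: poly_endo_def f.zero)

lemma poly_endo_add: "poly_endo (p + q) v = poly_endo p v + poly_endo q v"
  by (induction p q rule: poly_induct2)
    (simp_all add: poly_endo_0 poly_endo_pCons f.add scale_left_distrib)

lemma poly_endo_smult: "poly_endo (smult c p) v = c *s poly_endo p v"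
  by (induction p) (simp_all add: poly_endo_0 poly_endo_pCons f.scale scale_right_distrib)

lemma poly_endo_sum: "poly_endo (\<Sum>i\<in>I. p i) v = (\<Sum>i\<in>I. poly_endo (p i) v)"
  by (induction I rule: infinite_finite_induct) (simp_all add: poly_endo_0 poly_endo_add)

lemma poly_endo_monom: "poly_endo (monom a i) v = a *s (f ^^ i) v"
  by (induction i) (simp_all add: monom_0 monom_Suc poly_endo_0 poly_endo_pCons f.scale f.zero)

lemma poly_endo_linear_factor: "poly_endo ([:- r, 1:] * q) v = shift r (poly_endo q v)"
proof -
  have "[:- r, 1:] * q = pCons 0 q + smult (- r) q" by simp
  then show ?thesis
    by (simp only: poly_endo_add poly_endo_smult poly_endo_pCons) (simp add: shift_def)
qed

lemma poly_endo_in_subspace: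
  assumes "subspace U" "f ` U \<subseteq> U" "v \<in> U"
  shows "poly_endo p v \<in> U"
  using assms by (induction p) (auto simp: poly_endo_0 poly_endo_pCons subspace_0 subspace_add subspace_scale)

text \<open>Without an annihilating polynomial the \<open>card B + 1\<close> iterates of
  \<open>v\<close> would be distinct and independent inside \<open>span B\<close>.\<close>

lemma annihilating_poly_exists:
  assumes U: "subspace U" "f ` U \<subseteq> U" "v \<in> U" and B: "finite B" "U \<subseteq> span B"
  shows "\<exists>p. p \<noteq> 0 \<and> poly_endo p v = 0"
proof (rule ccontr)
  assume "\<not> ?thesis"
  then have no: "p = 0" if "poly_endo p v = 0" for p using that by blast
  define w where "w i = (f ^^ i) v" for i
  have w: "w i = poly_endo (monom 1 i) v" for i by (simp add: poly_endo_monom w_def)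
  \<comment> \<open>Two equal iterates would give an annihilating difference of monomials.\<close>
  have inj: "inj_on w {..card B}"
  proof (rule inj_onI)
    fix i j assume "w i = w j"
    then have "poly_endo (monom 1 i + smult (- 1) (monom 1 j)) v = 0"
      by (simp only: poly_endo_add poly_endo_smult w) simp
    from no[OF this] have "monom (1::complex) i = monom 1 j" by simp
    then show "i = j" by (simp add: monom_eq_iff')
  qed
  have "independent (w ` {..card B})"
    unfolding dependent_finite[OF finite_imageI[OF finite_atMost]]
  proof clarify
    fix u i assume i: "i \<le> card B" "u (w i) \<noteq> 0" and s: "(\<Sum>v\<in>w ` {..card B}. u v *s v) = 0"
    have "poly_endo (\<Sum>i\<le>card B. monom (u (w i)) i) v = 0"
      using s by (simp add: poly_endo_sum poly_endo_monom sum.reindex[OF inj] flip: w_def)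
    from no[OF this] have "coeff (\<Sum>i\<le>card B. monom (u (w i)) i) i = 0" by simp
    with i show False by (simp add: coeff_sum if_distrib[of "\<lambda>x. x = _"] sum.delta')
  qed
  moreover have "w ` {..card B} \<subseteq> span B"
    using poly_endo_in_subspace[OF U] B(2) by (auto simp: w)
  ultimately have "card (w ` {..card B}) \<le> card B"
    using independent_span_bound[OF B(1)] by blast
  then show False by (simp add: card_image[OF inj])
qed

text \<open>Take an annihilating polynomial of \<open>v\<close> of least degree. It is not constant
  because \<open>v\<close> is nonzero, so it has a root \<open>r\<close>. By minimality the cofactor
  \<open>q\<close> of the linear factor gives a nonzero vector, which \<open>shift r\<close>
  kills.\<close>

lemma eigenvector_exists:
  assumes U: "subspace U" "f ` U \<subseteq> U" "finite B" "U \<subseteq> span B" and v: "v \<in> U" "v \<noteq> 0"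
  shows "\<exists>l w. w \<in> U \<and> w \<noteq> 0 \<and> shift l w = 0"
proof -
  define P where "P p \<longleftrightarrow> p \<noteq> 0 \<and> poly_endo p v = 0" for p
  obtain p where p: "P p" "\<And>q. P q \<Longrightarrow> degree p \<le> degree q"
    using annihilating_poly_exists[OF U(1,2) v(1) U(3,4)] ex_has_least_nat[of P _ degree]
    unfolding P_def by metis
  have "degree p \<noteq> 0"
  proof
    assume "degree p = 0"
    then obtain a where "p = [:a:]" by (rule degree_eq_zeroE)
    then show False using p(1) v by (auto simp: P_def poly_endo_pCons poly_endo_0 f.zero)
  qed
  then obtain r where "poly p r = 0"
    using fundamental_theorem_of_algebra[of p] by (auto simp: constant_degree)
  then obtain q where q: "p = [:- r, 1:] * q" by (auto simp: poly_eq_0_iff_dvd)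
  then have "q \<noteq> 0" "degree q < degree p"
    using p(1) by (auto simp: P_def degree_mult_eq simp del: mult_pCons_left)
  then have "poly_endo q v \<noteq> 0" using p(2)[of q] by (auto simp: P_def)
  moreover have "shift r (poly_endo q v) = 0"
    using p(1) poly_endo_linear_factor[of r q v] q by (simp add: P_def)
  ultimately show ?thesis using poly_endo_in_subspace[OF U(1,2) v(1)] by blast
qed

section \<open>Building a Jordan basis by prolonging chains\<close>

lemma distinct_heads:
  assumes "distinct (concat (map snd cs))" "\<forall>c\<in>set cs. snd c \<noteq> []"
  shows "distinct (map (hd \<circ> snd) (filter P cs))"
  using assms
proof (induction cs)
  case (Cons c cs)
  have "hd (snd d) \<in> set (concat (map snd cs))" if "d \<in> set cs" for d
    using that Cons.prems(2) by (auto intro!: bexI[of _ d])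
  moreover have "hd (snd c) \<in> set (snd c)" using Cons.prems(2) by simp
  moreover have "set (snd c) \<inter> set (concat (map snd cs)) = {}" using Cons.prems(1) by simp
  ultimately have "hd (snd c) \<noteq> hd (snd d)" if "d \<in> set cs" for d
    using that by (metis disjoint_iff)
  then show ?case using Cons by auto
qed simp

text \<open>Independence of the new family is not checked directly: it spans \<open>U\<close> and
  has at most \<open>card B\<close> members, which suffices.\<close>

lemma chains_basis_exists:
  assumes "finite B" "independent B" "span B = U" "f ` U \<subseteq> U"
  shows "\<exists>cs. chains_basis U cs"
  using assms
proof (induction "card B" arbitrary: B U rule: less_induct)
  case less
  note B = less.prems(1-3) and fU = less.prems(4)
  have U: "subspace U" using B by auto
  have UB: "U \<subseteq> span B" and BU: "B \<subseteq> U" using B span_superset by auto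
  show ?case
  proof (cases "U \<subseteq> {0}")
    case True
    then have "chains_basis U []" using U independent_empty by (auto simp: chains_basis_def subspace_0)
    then show ?thesis by blast
  next
    case False
    then obtain l v where v: "v \<in> U" "v \<noteq> 0" "shift l v = 0"
      using eigenvector_exists[OF U fU B(1) UB] by blast
    define W where "W = shift l ` U"
    have WU: "W \<subseteq> U"
      using fU U by (auto simp: W_def shift_def subspace_diff subspace_scale)
    have W: "subspace W" unfolding W_def by (rule shift.subspace_image[OF U])
    have fW: "f ` W \<subseteq> W" using fU by (auto simp: W_def f_shift_commute)
    obtain B' where B': "B' \<subseteq> W" "independent B'" "W \<subseteq> span B'" by (rule basis_exists)
    have sB': "span B' = W" using B' W by (simp add: span_subspace)
    \<comment> \<open>The eigenvector \<open>v\<close> alone already makes the image strictly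
      smaller, so the induction hypothesis applies to \<open>W\<close>.\<close>
    have "finite B' \<and> card {v} + card B' \<le> card B"
      using card_kernel_plus_card_image_le[OF linear_shift U UB B(1), of "{v}" l B'] v B'
      by (auto simp: W_def)
    then obtain cs where cs: "chains_basis W cs"
      using less.hyps[OF _ _ B'(2) sB' fW] by auto
    define L where "L = concat (map snd cs)"
    have L: "distinct L" "independent (set L)" "span (set L) = W" "set L \<subseteq> W"
      using cs span_superset[of "set L"] by (auto simp: chains_basis_def L_def)
    have ch: "snd c \<noteq> []" "chain (fst c) (snd c)" "set (snd c) \<subseteq> set L" if "c \<in> set cs" for c
      using cs that by (auto simp: chains_basis_def L_def)
    interpret p: vector_space_pair scale scale by unfold_locales
    \<comment> \<open>\<open>h\<close> picks preimages within \<open>U\<close>; it supplies the new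
      last vectors of the chains for \<open>l\<close>.\<close>
    obtain h where h: "range h \<subseteq> U" "\<forall>w\<in>W. shift l (h w) = w"
      using p.linear_exists_right_inverse_on[OF linear_shift U] unfolding W_def by metis
    let ?heads = "map (hd \<circ> snd) (filter (\<lambda>c. fst c = l) cs)"
    have heads: "distinct ?heads"
      using cs by (intro distinct_heads) (auto simp: chains_basis_def)
    have heads_L: "set ?heads \<subseteq> set L" using ch by fastforce
    have "shift l (hd (snd c)) = 0" if "c \<in> set cs" "fst c = l" for c
      using ch[OF that(1)] that(2) by (auto simp: chain_def hd_conv_nth)
    then have "\<forall>x\<in>set ?heads. shift l x = 0" by auto
    moreover have "set ?heads \<subseteq> U" using heads_L L(4) WU by (meson order_trans)
    ultimately have heads_ker: "set ?heads \<subseteq> {x \<in> U. shift l x = 0}" by blast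
    have "independent (set ?heads)" using independent_mono[OF L(2) heads_L] .
    then obtain Z where Z: "set ?heads \<subseteq> Z" "Z \<subseteq> {x \<in> U. shift l x = 0}" "independent Z"
        "{x \<in> U. shift l x = 0} \<subseteq> span Z"
      by (rule maximal_independent_subset_extend[OF heads_ker])
    have card: "finite Z \<and> card Z + card (set L) \<le> card B"
      using card_kernel_plus_card_image_le[OF linear_shift U UB B(1) Z(3), of l "set L"] Z(2) L(2,4)
      by (auto simp: W_def)
    obtain zs where zs: "set zs = Z - set ?heads" "distinct zs"
      using card finite_distinct_list by (metis finite_Diff)
    \<comment> \<open>The heads of the chains for \<open>l\<close> are already part of the kernel
      basis \<open>Z\<close>; the rest of \<open>Z\<close> becomes chains of length one.\<close>
    define ds where "ds = map (\<lambda>c. (fst c, if fst c = l then snd c @ [h (last (snd c))] else snd c)) cs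
      @ map (\<lambda>z. (l, [z])) zs"
    let ?D = "concat (map snd ds)"
    have "length (concat (map (\<lambda>c. if fst c = l then snd c @ [h (last (snd c))] else snd c) cs))
        = length L + length ?heads"
      unfolding L_def by (induction cs) auto
    \<comment> \<open>There is one new vector per head, and the heads are distinct. Since
      \<open>zs\<close> lists \<open>Z\<close> without the heads, the sum is
      \<open>card (set L) + card Z\<close>, which \<open>card\<close> bounds.\<close>
    then have "length ?D = length L + length ?heads + length zs"
      by (simp add: ds_def comp_def sum_list_triv)
    also have "length ?heads = card (set ?heads)" using heads by (simp only: distinct_card)
    also have "length zs = card Z - card (set ?heads)"
      using zs card Z(1) by (metis card_Diff_subset distinct_card List.finite_set)
    also have "length L = card (set L)" using L(1) by (simp only: distinct_card)
    finally have len: "length ?D \<le> card B"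
      using card card_mono[of Z "set ?heads"] Z(1) by linarith
    have LD: "set L \<subseteq> set ?D" by (auto simp: L_def ds_def split: if_splits)
    have ZD: "Z \<subseteq> set ?D"
      using heads_L LD zs(1) by (auto simp: ds_def)
    have hD: "h (last (snd c)) \<in> set ?D" if "c \<in> set cs" "fst c = l" for c
      using that by (force simp: ds_def)
    \<comment> \<open>In a chain for \<open>l\<close>, a vector is the image of its successor in the
      prolonged chain; for the former last vector this successor is the one added by
      \<open>h\<close>.\<close>
    have "x \<in> shift l ` span (set ?D)" if x: "x \<in> set L" for x
    proof -
      obtain c where c: "c \<in> set cs" "x \<in> set (snd c)" using x by (auto simp: L_def)
      have sub: "set (snd c) \<subseteq> set ?D" using ch[OF c(1)] LD by blast
      show ?thesis
      proof (cases "fst c = l")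
        case False
        then have "x \<in> shift l ` span (set (snd c))"
          using span_chain_subset_shift[OF ch(2)[OF c(1)], of l] c(2) by (auto intro: span_base)
        then show ?thesis using span_mono[OF sub] by blast
      next
        case True
        obtain i where i: "i < length (snd c)" "x = snd c ! i" using c by (auto simp: in_set_conv_nth)
        show ?thesis
        proof (cases "Suc i < length (snd c)")
          case True
          then have "x = shift l (snd c ! Suc i)"
            using ch(2)[OF c(1)] \<open>fst c = l\<close> i by (simp add: chain_def)
          then show ?thesis using True sub by (auto intro!: imageI span_base nth_mem)
        next
          case False
          then have "x = last (snd c)" using i ch(1)[OF c(1)]
            by (metis Suc_lessI diff_Suc_1 last_conv_nth)
          then have "x = shift l (h (last (snd c)))" using h(2) x L(4) by auto
          then show ?thesis using hD[OF c(1) True] by (auto intro!: imageI span_base)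
        qed
      qed
    qed
    then have WD: "W \<subseteq> shift l ` span (set ?D)"
      unfolding L(3)[symmetric] by (intro span_minimal shift.subspace_image) auto
    have DU: "set ?D \<subseteq> U"
    proof -
      have "h x \<in> U" for x using h(1) by auto
      moreover have "set (snd c) \<subseteq> U" if "c \<in> set cs" for c using ch(3)[OF that] L(4) WU by blast
      moreover have "set zs \<subseteq> U" using zs(1) Z(2) by blast
      ultimately show ?thesis by (auto simp: ds_def split: if_splits)
    qed
    have sDU: "span (set ?D) \<subseteq> U" by (rule span_minimal[OF DU U])
    \<comment> \<open>Some vector of the span has the same image as \<open>u\<close>; the difference
      lies in the kernel, which \<open>Z\<close> spans.\<close>
    have "u \<in> span (set ?D)" if u: "u \<in> U" for u
    proof -
      obtain u' where u': "shift l u = shift l u'" "u' \<in> span (set ?D)"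
        using WD u unfolding W_def by blast
      then have "u - u' \<in> {x \<in> U. shift l x = 0}"
        using u sDU U by (auto simp: shift.diff subspace_diff)
      then have "u - u' \<in> span (set ?D)" using Z(4) span_mono[OF ZD] by blast
      then show ?thesis using span_add[OF _ u'(2)] by force
    qed
    then have UD: "U \<subseteq> span (set ?D)" by blast
    have "distinct ?D \<and> independent (set ?D)"
      by (rule distinct_independent_if_spanning_list[OF B(1,2) BU UD len])
    moreover have "\<forall>c\<in>set ds. snd c \<noteq> [] \<and> chain (fst c) (snd c)"
    proof -
      have "chain l (snd c @ [h (last (snd c))])" if "c \<in> set cs" "fst c = l" for c
      proof (rule chain_snoc)
        have "last (snd c) \<in> W" using ch[OF that(1)] L(4) by (meson last_in_set subsetD)
        then show "shift l (h (last (snd c))) = last (snd c)" using h(2) by blast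
      qed (use ch[OF that(1)] that(2) in auto)
      moreover have "chain l [z]" if "z \<in> set zs" for z
        using that zs(1) Z(2) by (auto simp: chain_def)
      ultimately show ?thesis using ch by (auto simp: ds_def split: if_splits)
    qed
    moreover have "span (set ?D) = U" using UD sDU by blast
    ultimately have "chains_basis U ds" unfolding chains_basis_def by blast
    then show ?thesis by blast
  qed
qed

end

section \<open>Transfer along an injective linear map\<close>

text \<open>Links the single list condition of \<open>chains_basis\<close> with the separate
  conditions of \<open>jordan_basis\<close>. A nonempty chain is not disjoint from itself, so
  disjointness also excludes repeated chains.\<close>

lemma distinct_concat_snd_iff:
  assumes "\<forall>c\<in>set cs. snd c \<noteq> []"
  shows "distinct (concat (map snd cs)) \<longleftrightarrow>
    distinct cs \<and> (\<forall>c\<in>set cs. distinct (snd c)) \<and>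
    (\<forall>c\<in>set cs. \<forall>d\<in>set cs. c \<noteq> d \<longrightarrow> set (snd c) \<inter> set (snd d) = {})"
  using assms
proof (induction cs)
  case (Cons c cs)
  define P where "P d e \<longleftrightarrow> set (snd d) \<inter> set (snd e) = {}" for d e :: "'a \<times> 'b list"
  have P: "P d e \<longleftrightarrow> P e d" for d e by (auto simp: P_def)
  have "\<not> P c c" using Cons.prems by (simp add: P_def)
  then have c: "(\<forall>d\<in>set cs. P c d) \<longleftrightarrow>
      c \<notin> set cs \<and> (\<forall>d\<in>set cs. c \<noteq> d \<longrightarrow> P c d) \<and> (\<forall>d\<in>set cs. d \<noteq> c \<longrightarrow> P d c)"
    using P by metis
  have "set (snd c) \<inter> set (concat (map snd cs)) = {} \<longleftrightarrow> (\<forall>d\<in>set cs. P c d)"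
    by (auto simp: P_def)
  then have "distinct (concat (map snd (c # cs))) \<longleftrightarrow>
      distinct (snd c) \<and> distinct (concat (map snd cs)) \<and> (\<forall>d\<in>set cs. P c d)"
    by (simp del: set_concat)
  also have "distinct (concat (map snd cs)) \<longleftrightarrow> distinct cs \<and> (\<forall>c\<in>set cs. distinct (snd c)) \<and>
      (\<forall>c\<in>set cs. \<forall>d\<in>set cs. c \<noteq> d \<longrightarrow> P c d)"
    unfolding P_def using Cons by simp
  also have "distinct (snd c) \<and> (distinct cs \<and> (\<forall>c\<in>set cs. distinct (snd c)) \<and>
      (\<forall>c\<in>set cs. \<forall>d\<in>set cs. c \<noteq> d \<longrightarrow> P c d)) \<and> (\<forall>d\<in>set cs. P c d) \<longleftrightarrow>
      distinct (c # cs) \<and> (\<forall>c\<in>set (c # cs). distinct (snd c)) \<and>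
      (\<forall>d\<in>set (c # cs). \<forall>e\<in>set (c # cs). d \<noteq> e \<longrightarrow> P d e)"
    unfolding c by (simp add: ball_conj_distrib) blast
  finally show ?case unfolding P_def .
qed simp

context vector_space_endo
begin

definition structure_of_chains :: "(complex \<times> 'b list) list \<Rightarrow> jordan_structure" where
  "structure_of_chains cs =
     \<lparr>eigenvalues = {l. lengths l cs \<noteq> {#}}, chain_lengths = (\<lambda>l. lengths l cs)\<rparr>"

end

text \<open>An injective linear map \<open>\<phi>\<close> intertwines \<open>T\<close> with
  \<open>f\<close>. Its image may be a proper subset of the type, so that one \<open>f\<close> can
  serve both \<open>V\<close> and its quotient.\<close>

locale coordinates = vector_space_endo scale f
  for scale :: "complex \<Rightarrow> 'b::ab_group_add \<Rightarrow> 'b" (infixr \<open>*s\<close> 75) and f +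
  fixes W :: "(complex, 'w) module" and \<phi> :: "'w \<Rightarrow> 'b" and T :: "'w \<Rightarrow> 'w"
  assumes inj: "inj_on \<phi> (carrier W)"
    and zero_closed: "\<zero>\<^bsub>W\<^esub> \<in> carrier W"
    and add_closed: "\<And>v w. v \<in> carrier W \<Longrightarrow> w \<in> carrier W \<Longrightarrow> v \<oplus>\<^bsub>W\<^esub> w \<in> carrier W"
    and smult_closed: "\<And>a v. v \<in> carrier W \<Longrightarrow> a \<odot>\<^bsub>W\<^esub> v \<in> carrier W"
    and T_closed: "\<And>v. v \<in> carrier W \<Longrightarrow> T v \<in> carrier W"
    and \<phi>_zero: "\<phi> \<zero>\<^bsub>W\<^esub> = 0"
    and \<phi>_add: "\<And>v w. v \<in> carrier W \<Longrightarrow> w \<in> carrier W \<Longrightarrow> \<phi> (v \<oplus>\<^bsub>W\<^esub> w) = \<phi> v + \<phi> w"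
    and \<phi>_smult: "\<And>a v. v \<in> carrier W \<Longrightarrow> \<phi> (a \<odot>\<^bsub>W\<^esub> v) = a *s \<phi> v"
    and \<phi>_T: "\<And>v. v \<in> carrier W \<Longrightarrow> \<phi> (T v) = f (\<phi> v)"
begin

lemmas closed = zero_closed add_closed smult_closed T_closed
lemmas \<phi>_simps = \<phi>_zero \<phi>_add \<phi>_smult \<phi>_T

lemma \<phi>_eq_iff: "v \<in> carrier W \<Longrightarrow> w \<in> carrier W \<Longrightarrow> \<phi> v = \<phi> w \<longleftrightarrow> v = w"
  by (rule inj_on_eq_iff[OF inj])

lemma \<phi>_eq_0_iff: "v \<in> carrier W \<Longrightarrow> \<phi> v = 0 \<longleftrightarrow> v = \<zero>\<^bsub>W\<^esub>"
  using \<phi>_eq_iff[OF _ zero_closed] by (simp add: \<phi>_zero)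

lemma eqI: "\<phi> v = \<phi> w \<Longrightarrow> v \<in> carrier W \<Longrightarrow> w \<in> carrier W \<Longrightarrow> v = w"
  by (simp add: \<phi>_eq_iff)

text \<open>The laws are pulled back along the injective \<open>\<phi>\<close>. For the quotient
  this replaces a verification of the laws on cosets.\<close>

lemma vectorspace_W: "vectorspace class_ring W"
proof (rule vs_criteria)
  show "\<forall>v\<in>carrier W. \<exists>w\<in>carrier W. v \<oplus>\<^bsub>W\<^esub> w = \<zero>\<^bsub>W\<^esub>"
  proof
    fix v assume "v \<in> carrier W"
    then show "\<exists>w\<in>carrier W. v \<oplus>\<^bsub>W\<^esub> w = \<zero>\<^bsub>W\<^esub>"
      by (intro bexI[of _ "(- 1) \<odot>\<^bsub>W\<^esub> v"] eqI) (simp_all add: closed \<phi>_simps)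
  qed
qed (auto intro!: eqI class_field
    simp: closed \<phi>_simps algebra_simps scale_left_distrib scale_right_distrib)

sublocale W: vectorspace "class_ring :: complex ring" W
  by (rule vectorspace_W)

lemma \<phi>_lincomb:
  assumes "finite S" "S \<subseteq> carrier W"
  shows "\<phi> (W.lincomb a S) = (\<Sum>v\<in>S. a v *s \<phi> v)"
  using assms
proof (induction S rule: finite_induct)
  case empty
  then show ?case by (simp add: W.lincomb_def \<phi>_zero)
next
  case (insert v S)
  have "W.lincomb a (insert v S) = (a v \<odot>\<^bsub>W\<^esub> v) \<oplus>\<^bsub>W\<^esub> W.lincomb a S"
    using W.lincomb_insert[of S a v] insert by simp
  moreover have "W.lincomb a S \<in> carrier W" using insert by (intro W.lincomb_closed) auto
  ultimately show ?case using insert by (simp add: \<phi>_simps closed)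
qed

lemma basis_iff:
  assumes S: "finite S" "S \<subseteq> carrier W"
  shows "W.basis S \<longleftrightarrow> independent (\<phi> ` S) \<and> span (\<phi> ` S) = \<phi> ` carrier W"
proof -
  have injS: "inj_on \<phi> S" using inj S(2) by (rule inj_on_subset)
  have sum: "(\<Sum>w\<in>\<phi> ` S. u w *s w) = \<phi> (W.lincomb (u \<circ> \<phi>) S)" for u
    by (simp add: \<phi>_lincomb[OF S] sum.reindex[OF injS])
  have pull: "\<exists>u. \<forall>v\<in>S. u (\<phi> v) = a v" for a :: "'w \<Rightarrow> complex"
    using injS by (intro exI[of _ "a \<circ> the_inv_into S \<phi>"]) (simp add: the_inv_into_f_f)
  have cl: "W.lincomb a S \<in> carrier W" for a using S by (intro W.lincomb_closed) auto
  have cong: "W.lincomb a S = W.lincomb b S" if "\<forall>v\<in>S. a v = b v" for a b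
    using that S by (intro W.lincomb_cong) auto
  have "W.lin_dep S \<longleftrightarrow> (\<exists>a. (\<exists>v\<in>S. a v \<noteq> 0) \<and> W.lincomb a S = \<zero>\<^bsub>W\<^esub>)"
    using W.finite_lin_dep[OF S(1) _ S(2)] W.lin_dep_crit[OF S(1) order.refl] by auto
  also have "\<dots> \<longleftrightarrow> (\<exists>u. (\<exists>v\<in>S. u (\<phi> v) \<noteq> 0) \<and> W.lincomb (u \<circ> \<phi>) S = \<zero>\<^bsub>W\<^esub>)"
  proof
    assume "\<exists>a. (\<exists>v\<in>S. a v \<noteq> 0) \<and> W.lincomb a S = \<zero>\<^bsub>W\<^esub>"
    then obtain a where a: "\<exists>v\<in>S. a v \<noteq> 0" "W.lincomb a S = \<zero>\<^bsub>W\<^esub>" by blast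
    obtain u where u: "\<forall>v\<in>S. u (\<phi> v) = a v" using pull by blast
    with a cong[of "u \<circ> \<phi>" a] show "\<exists>u. (\<exists>v\<in>S. u (\<phi> v) \<noteq> 0) \<and> W.lincomb (u \<circ> \<phi>) S = \<zero>\<^bsub>W\<^esub>"
      by (intro exI[of _ u]) auto
  next
    assume "\<exists>u. (\<exists>v\<in>S. u (\<phi> v) \<noteq> 0) \<and> W.lincomb (u \<circ> \<phi>) S = \<zero>\<^bsub>W\<^esub>"
    then obtain u where "\<exists>v\<in>S. (u \<circ> \<phi>) v \<noteq> 0" "W.lincomb (u \<circ> \<phi>) S = \<zero>\<^bsub>W\<^esub>" by auto
    then show "\<exists>a. (\<exists>v\<in>S. a v \<noteq> 0) \<and> W.lincomb a S = \<zero>\<^bsub>W\<^esub>" by blast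
  qed
  also have "\<dots> \<longleftrightarrow> dependent (\<phi> ` S)"
    unfolding dependent_finite[OF finite_imageI[OF S(1)]] sum by (simp add: \<phi>_eq_0_iff[OF cl])
  finally have dep: "W.lin_dep S \<longleftrightarrow> dependent (\<phi> ` S)" .
  have "\<phi> ` W.span S = span (\<phi> ` S)"
  proof -
    have "W.span S = range (\<lambda>a. W.lincomb a S)"
      using W.finite_span[OF S] by auto
    moreover have "span (\<phi> ` S) = range (\<lambda>u. \<phi> (W.lincomb (u \<circ> \<phi>) S))"
      unfolding span_finite[OF finite_imageI[OF S(1)]] sum ..
    moreover have "\<phi> (W.lincomb a S) \<in> range (\<lambda>u. \<phi> (W.lincomb (u \<circ> \<phi>) S))" for a
    proof -
      obtain u where "\<forall>v\<in>S. u (\<phi> v) = a v" using pull by blast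
      then have "W.lincomb a S = W.lincomb (u \<circ> \<phi>) S" by (intro cong) auto
      then show ?thesis by auto
    qed
    ultimately show ?thesis by auto
  qed
  moreover have "W.span S = carrier W \<longleftrightarrow> \<phi> ` W.span S = \<phi> ` carrier W"
    using inj_on_image_eq_iff[OF inj, of "W.span S" "carrier W"] W.span_is_subset2[OF S(2)] by auto
  ultimately show ?thesis using dep S(2) unfolding W.basis_def by auto
qed

lemma jordan_chain_iff:
  assumes vs: "set vs \<subseteq> carrier W"
  shows "jordan_chain W T l vs \<longleftrightarrow> vs \<noteq> [] \<and> vs ! 0 \<noteq> \<zero>\<^bsub>W\<^esub> \<and> chain l (map \<phi> vs)"
proof -
  have mem: "vs ! i \<in> carrier W" if "i < length vs" for i using vs that by auto
  have 0: "shift l (\<phi> (vs ! 0)) = 0 \<longleftrightarrow> T (vs ! 0) = l \<odot>\<^bsub>W\<^esub> (vs ! 0)" if "vs \<noteq> []"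
    using mem[of 0] that \<phi>_eq_iff[of "T (vs ! 0)" "l \<odot>\<^bsub>W\<^esub> (vs ! 0)"]
    by (simp add: shift_def \<phi>_simps closed)
  have Suc: "shift l (\<phi> (vs ! Suc i)) = \<phi> (vs ! i) \<longleftrightarrow>
      T (vs ! Suc i) = (l \<odot>\<^bsub>W\<^esub> (vs ! Suc i)) \<oplus>\<^bsub>W\<^esub> (vs ! i)" if "Suc i < length vs" for i
    using mem[of i] mem[of "Suc i"] that
      \<phi>_eq_iff[of "T (vs ! Suc i)" "(l \<odot>\<^bsub>W\<^esub> (vs ! Suc i)) \<oplus>\<^bsub>W\<^esub> (vs ! i)"]
    by (simp add: shift_def \<phi>_simps closed diff_eq_eq add.commute)
  have "chain l (map \<phi> vs) \<longleftrightarrow> shift l (\<phi> (vs ! 0)) = 0 \<and>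
      (\<forall>i. Suc i < length vs \<longrightarrow> shift l (\<phi> (vs ! Suc i)) = \<phi> (vs ! i))" if "vs \<noteq> []"
    unfolding chain_def
  proof (intro iffI conjI allI impI)
    assume *: "\<forall>i<length (map \<phi> vs).
        shift l (map \<phi> vs ! i) = (if i = 0 then 0 else map \<phi> vs ! (i - 1))"
    from *[rule_format, of 0] that show "shift l (\<phi> (vs ! 0)) = 0" by simp
    fix i assume "Suc i < length vs"
    with *[rule_format, of "Suc i"] show "shift l (\<phi> (vs ! Suc i)) = \<phi> (vs ! i)" by simp
  next
    fix i assume "shift l (\<phi> (vs ! 0)) = 0 \<and>
      (\<forall>i. Suc i < length vs \<longrightarrow> shift l (\<phi> (vs ! Suc i)) = \<phi> (vs ! i))" "i < length (map \<phi> vs)"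
    then show "shift l (map \<phi> vs ! i) = (if i = 0 then 0 else map \<phi> vs ! (i - 1))"
      by (cases i) auto
  qed
  then show ?thesis using vs 0 Suc unfolding jordan_chain_def by auto
qed

text \<open>\<open>jordan_basis\<close> speaks of a set of chains and \<open>chains_basis\<close> of
  a list; \<open>distinct cs\<close> accounts for the difference.\<close>

lemma jordan_basis_iff:
  assumes cs: "\<forall>c\<in>set cs. set (snd c) \<subseteq> carrier W"
  shows "chains_basis (\<phi> ` carrier W) (map (\<lambda>c. (fst c, map \<phi> (snd c))) cs) \<longleftrightarrow>
    jordan_basis W T (set cs) \<and> distinct cs"
proof -
  define X where "X = concat (map snd cs)"
  have X: "set X \<subseteq> carrier W" using cs by (auto simp: X_def)
  have concat: "concat (map snd (map (\<lambda>c. (fst c, map \<phi> (snd c))) cs)) = map \<phi> X"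
    by (simp add: X_def map_concat comp_def)
  have dX: "distinct (map \<phi> X) \<longleftrightarrow> distinct X"
    using inj_on_subset[OF inj X] by (simp add: distinct_map)
  have UX: "(\<Union>c\<in>set cs. set (snd c)) = set X" by (auto simp: X_def)
  note basis = basis_iff[OF _ X, simplified]
  have ch: "jordan_chain W T l vs \<longleftrightarrow> vs \<noteq> [] \<and> vs ! 0 \<noteq> \<zero>\<^bsub>W\<^esub> \<and> chain l (map \<phi> vs)"
    if "(l, vs) \<in> set cs" for l vs
    using cs that by (intro jordan_chain_iff) force
  show ?thesis
  proof
    assume *: "chains_basis (\<phi> ` carrier W) (map (\<lambda>c. (fst c, map \<phi> (snd c))) cs)"
    then have ne: "\<forall>c\<in>set cs. snd c \<noteq> [] \<and> chain (fst c) (map \<phi> (snd c))" and d: "distinct X"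
      and ind: "independent (\<phi> ` set X)" and sp: "span (\<phi> ` set X) = \<phi> ` carrier W"
      unfolding chains_basis_def concat by (simp_all add: dX)
    \<comment> \<open>\<open>chain\<close> does not force a nonzero head; independence does.\<close>
    have nz: "vs ! 0 \<noteq> \<zero>\<^bsub>W\<^esub>" if "(l, vs) \<in> set cs" for l vs
    proof
      assume "vs ! 0 = \<zero>\<^bsub>W\<^esub>"
      moreover have "vs ! 0 \<in> set X" using that ne by (force simp: X_def)
      ultimately have "0 \<in> \<phi> ` set X" by (metis \<phi>_zero imageI)
      then show False using ind dependent_zero by blast
    qed
    have dd: "distinct cs \<and> (\<forall>c\<in>set cs. distinct (snd c)) \<and>
        (\<forall>c\<in>set cs. \<forall>d\<in>set cs. c \<noteq> d \<longrightarrow> set (snd c) \<inter> set (snd d) = {})"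
      using d ne distinct_concat_snd_iff[of cs] unfolding X_def by blast
    have "jordan_chain W T l vs \<and> distinct vs" if "(l, vs) \<in> set cs" for l vs
      using ch[OF that] nz[OF that] bspec[OF ne that] dd that by force
    moreover have "W.basis (set X)" using basis ind sp by blast
    ultimately have "jordan_basis W T (set cs)"
      unfolding jordan_basis_def UX using dd by (intro conjI) blast+
    then show "jordan_basis W T (set cs) \<and> distinct cs" using dd by blast
  next
    assume *: "jordan_basis W T (set cs) \<and> distinct cs"
    then have jc: "jordan_chain W T l vs \<and> distinct vs" if "(l, vs) \<in> set cs" for l vs
      using that unfolding jordan_basis_def by blast
    have ne: "\<forall>c\<in>set cs. snd c \<noteq> [] \<and> chain (fst c) (map \<phi> (snd c))"
    proof
      fix c assume "c \<in> set cs"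
      then show "snd c \<noteq> [] \<and> chain (fst c) (map \<phi> (snd c))"
        using ch[of "fst c" "snd c"] jc[of "fst c" "snd c"] by simp
    qed
    moreover have "distinct X"
    proof -
      have "\<forall>c\<in>set cs. distinct (snd c)" using jc by auto
      then show ?thesis
        using * ne distinct_concat_snd_iff[of cs] unfolding X_def jordan_basis_def by blast
    qed
    moreover have "independent (\<phi> ` set X)" "span (\<phi> ` set X) = \<phi> ` carrier W"
      using * basis unfolding jordan_basis_def UX by blast+
    ultimately show "chains_basis (\<phi> ` carrier W) (map (\<lambda>c. (fst c, map \<phi> (snd c))) cs)"
      unfolding chains_basis_def concat by (simp add: dX)
  qed
qed

lemma lengths_map:
  assumes "distinct cs"
  shows "lengths l (map (\<lambda>c. (fst c, map \<phi> (snd c))) cs) =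
    image_mset (\<lambda>(_, vs). length vs) (mset_set {c \<in> set cs. fst c = l})"
proof -
  have "mset_set {c \<in> set cs. fst c = l} = mset (filter (\<lambda>c. fst c = l) cs)"
    using mset_set_set[of "filter (\<lambda>c. fst c = l) cs"] assms by simp
  moreover have "lengths l (map (\<lambda>c. (fst c, map \<phi> (snd c))) cs) =
      image_mset (\<lambda>(_, vs). length vs) (mset (filter (\<lambda>c. fst c = l) cs))"
    by (induction cs) (auto simp: lengths_def)
  ultimately show ?thesis by simp
qed

lemma lin_eigenvalues_eq: "lin_eigenvalues W T = {l. \<exists>v\<in>\<phi> ` carrier W. v \<noteq> 0 \<and> f v = l *s v}"
proof -
  have "T v = l \<odot>\<^bsub>W\<^esub> v \<longleftrightarrow> f (\<phi> v) = l *s \<phi> v" if "v \<in> carrier W" for v l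
    using that \<phi>_eq_iff[of "T v" "l \<odot>\<^bsub>W\<^esub> v"] by (simp add: closed \<phi>_simps)
  then show ?thesis by (auto simp: lin_eigenvalues_def \<phi>_eq_0_iff)
qed

text \<open>Any set of chains witnessing \<open>S\<close> can be listed and mapped by
  \<open>\<phi>\<close>, where \<open>lengths_unique\<close> compares it with \<open>cs\<close>.
  Conversely, \<open>cs\<close> itself is pulled back to \<open>W\<close>.\<close>

lemma is_jordan_structure_iff:
  assumes J: "chains_basis (\<phi> ` carrier W) cs"
  shows "is_jordan_structure W T S \<longleftrightarrow> S = structure_of_chains cs"
proof -
  have ev: "lin_eigenvalues W T = {l. lengths l cs \<noteq> {#}}"
    unfolding lin_eigenvalues_eq using eigenvalue_iff_lengths[OF J] by simp
  show ?thesis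
  proof
    assume S: "is_jordan_structure W T S"
    then obtain C where C: "jordan_basis W T C"
      "\<And>l. chain_lengths S l = image_mset (\<lambda>(_, vs). length vs) (mset_set {c \<in> C. fst c = l})"
      unfolding is_jordan_structure_def by blast
    have "finite C" and chains: "\<forall>(l, vs)\<in>C. jordan_chain W T l vs"
      using C(1) unfolding jordan_basis_def by auto
    obtain ds where ds: "set ds = C" "distinct ds"
      using finite_distinct_list[OF \<open>finite C\<close>] by blast
    have "\<forall>c\<in>set ds. set (snd c) \<subseteq> carrier W"
    proof
      fix c assume "c \<in> set ds"
      then have "jordan_chain W T (fst c) (snd c)" using chains ds(1) by (auto split: prod.splits)
      then show "set (snd c) \<subseteq> carrier W" by (simp add: jordan_chain_def)
    qed
    from jordan_basis_iff[OF this]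
    have "chains_basis (\<phi> ` carrier W) (map (\<lambda>c. (fst c, map \<phi> (snd c))) ds)"
      using C(1) ds by simp
    from lengths_unique[OF this J] have "chain_lengths S = (\<lambda>l. lengths l cs)"
      using C(2) ds(1) by (simp add: lengths_map[OF ds(2)] fun_eq_iff)
    then show "S = structure_of_chains cs"
      using S ev unfolding is_jordan_structure_def structure_of_chains_def by (cases S) simp
  next
    assume S: "S = structure_of_chains cs"
    define ds where "ds = map (\<lambda>c. (fst c, map (inv_into (carrier W) \<phi>) (snd c))) cs"
    have cs: "set (snd c) \<subseteq> \<phi> ` carrier W" if "c \<in> set cs" for c
    proof -
      have "set (snd c) \<subseteq> set (concat (map snd cs))" using that by auto
      then show ?thesis using J span_superset unfolding chains_basis_def by blast
    qed
    have "map \<phi> (map (inv_into (carrier W) \<phi>) vs) = vs" if "set vs \<subseteq> \<phi> ` carrier W" for vs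
      using that by (induction vs) (auto simp: f_inv_into_f)
    then have cs_eq: "map (\<lambda>c. (fst c, map \<phi> (snd c))) ds = cs"
      using cs by (auto simp: ds_def comp_def intro!: map_idI)
    have "\<forall>c\<in>set ds. set (snd c) \<subseteq> carrier W"
    proof
      fix d assume "d \<in> set ds"
      then obtain c where c: "c \<in> set cs" "snd d = map (inv_into (carrier W) \<phi>) (snd c)"
        by (auto simp: ds_def)
      show "set (snd d) \<subseteq> carrier W"
        using cs[OF c(1)] inv_into_into[of _ \<phi> "carrier W"] unfolding c(2) by auto
    qed
    from jordan_basis_iff[OF this] have "jordan_basis W T (set ds)" "distinct ds"
      using J cs_eq by simp_all
    moreover have "lengths l cs = image_mset (\<lambda>(_, vs). length vs) (mset_set {c \<in> set ds. fst c = l})" for l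
      using lengths_map[OF \<open>distinct ds\<close>, of l] cs_eq by simp
    ultimately show "is_jordan_structure W T S"
      unfolding is_jordan_structure_def S structure_of_chains_def by (auto simp: ev)
  qed
qed

text \<open>This justifies the \<open>THE\<close> in \<open>jordan_structure_of\<close>.\<close>

lemma jordan_structure_of_eq:
  assumes "chains_basis (\<phi> ` carrier W) cs"
  shows "\<exists>!S. is_jordan_structure W T S" "jordan_structure_of W T = structure_of_chains cs"
  using is_jordan_structure_iff[OF assms] by (auto simp: jordan_structure_of_def)

end

section \<open>Coordinates with respect to a basis\<close>

abbreviation fun_scale :: "complex \<Rightarrow> ('v \<Rightarrow> complex) \<Rightarrow> 'v \<Rightarrow> complex" where
  "fun_scale c x \<equiv> \<lambda>b. c * x b"

lemma vector_space_fun_scale: "vector_space fun_scale"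
  by unfold_locales (auto simp: fun_eq_iff algebra_simps)

text \<open>Coordinates with respect to a basis \<open>\<beta>\<close> are extended by 0 to all of
  \<open>'v\<close>; such functions form the subspace \<open>X\<close>, and \<open>\<phi>\<close>
  inverts the linear combination map \<open>\<psi>\<close> on it.\<close>

lemma ex_coordinates:
  fixes V :: "(complex, 'v) module" and A :: "'v \<Rightarrow> 'v"
  assumes vs: "vectorspace class_ring V" and fd: "vectorspace.fin_dim class_ring V"
    and A: "linear_map class_ring V V A"
  shows "\<exists>(f :: ('v \<Rightarrow> complex) \<Rightarrow> 'v \<Rightarrow> complex) \<phi>. coordinates fun_scale f V \<phi> A"
proof -
  interpret V: vectorspace "class_ring :: complex ring" V by (rule vs)
  interpret A: linear_map "class_ring :: complex ring" V V A by (rule A)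
  obtain \<beta> where \<beta>: "finite \<beta>" "V.basis \<beta>" using V.finite_basis_exists[OF fd] by blast
  then have \<beta>V: "\<beta> \<subseteq> carrier V" by (simp add: V.basis_def)
  define \<psi> where "\<psi> x = V.lincomb x \<beta>" for x
  define X :: "('v \<Rightarrow> complex) set" where "X = {x. \<forall>b. b \<notin> \<beta> \<longrightarrow> x b = 0}"
  have \<psi>_closed: "\<psi> x \<in> carrier V" for x
    unfolding \<psi>_def using \<beta>V by (intro V.lincomb_closed) auto
  have \<psi>_cong: "\<psi> x = \<psi> y" if "\<And>b. b \<in> \<beta> \<Longrightarrow> x b = y b" for x y
    unfolding \<psi>_def using \<beta>V that by (intro V.lincomb_cong) auto
  have \<psi>_add: "\<psi> (x + y) = \<psi> x \<oplus>\<^bsub>V\<^esub> \<psi> y" for x y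
    using V.lincomb_sum[OF \<beta>(1) \<beta>V, of x y] by (simp add: \<psi>_def plus_fun_def)
  have \<psi>_scale: "\<psi> (fun_scale c x) = c \<odot>\<^bsub>V\<^esub> \<psi> x" for c x
    using V.lincomb_smult[OF \<beta>V, of x c] by (simp add: \<psi>_def)
  \<comment> \<open>These coefficient functions are \<open>undefined\<close> off
    \<open>\<beta>\<close>, whereas members of \<open>X\<close> are 0 there. Restriction and
    extension by 0 convert between the two, as \<open>\<psi>\<close> only sees values on
    \<open>\<beta>\<close>.\<close>
  have unique: "\<exists>!a. a \<in> \<beta> \<rightarrow>\<^sub>E UNIV \<and> V.lincomb a \<beta> = v" if "v \<in> carrier V" for v
    using V.basis_criterion[OF \<beta>(1) \<beta>V] \<beta>(2) that by simp
  have "bij_betw \<psi> X (carrier V)"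
    unfolding bij_betw_def
  proof
    show "inj_on \<psi> X"
    proof (rule inj_onI)
      fix x y assume xy: "x \<in> X" "y \<in> X" "\<psi> x = \<psi> y"
      have res: "V.lincomb (restrict z \<beta>) \<beta> = \<psi> z" for z
        unfolding \<psi>_def[symmetric] by (intro \<psi>_cong) simp
      have E: "restrict z \<beta> \<in> \<beta> \<rightarrow>\<^sub>E UNIV" for z :: "'v \<Rightarrow> complex" by simp
      obtain a where a: "\<And>b. b \<in> \<beta> \<rightarrow>\<^sub>E UNIV \<Longrightarrow> V.lincomb b \<beta> = \<psi> x \<Longrightarrow> b = a"
        using unique[OF \<psi>_closed[of x]] by (elim ex1E) blast
      have "restrict x \<beta> = restrict y \<beta>"
        using a[OF E res] a[OF E] res[of y] xy(3) by simp
      then have "x b = y b" if "b \<in> \<beta>" for b using that by (metis restrict_apply')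
      moreover have "x b = y b" if "b \<notin> \<beta>" for b using that xy(1,2) by (simp add: X_def)
      ultimately show "x = y" by blast
    qed
    have "v \<in> \<psi> ` X" if v: "v \<in> carrier V" for v
    proof -
      obtain a where "V.lincomb a \<beta> = v" using unique[OF v] by (elim ex1E) blast
      moreover have "\<psi> a = \<psi> (\<lambda>b. if b \<in> \<beta> then a b else 0)" by (rule \<psi>_cong) simp
      ultimately have "v = \<psi> (\<lambda>b. if b \<in> \<beta> then a b else 0)" by (simp add: \<psi>_def)
      then show ?thesis by (rule image_eqI[of _ \<psi>]) (simp add: X_def)
    qed
    then show "\<psi> ` X = carrier V" using \<psi>_closed by auto
  qed
  define \<phi> where "\<phi> = the_inv_into X \<psi>"
  have inj: "inj_on \<psi> X" and surj: "\<psi> ` X = carrier V"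
    using \<open>bij_betw \<psi> X (carrier V)\<close> by (simp_all add: bij_betw_def)
  have \<phi>I: "\<phi> v = x" if "x \<in> X" "\<psi> x = v" for v x
    using the_inv_into_f_f[OF inj that(1)] that(2) by (simp add: \<phi>_def)
  have \<phi>: "\<phi> v \<in> X" "\<psi> (\<phi> v) = v" if "v \<in> carrier V" for v
  proof -
    have "v \<in> \<psi> ` X" using that surj by simp
    then obtain x where "x \<in> X" "\<psi> x = v" by (elim imageE) simp
    then show "\<phi> v \<in> X" "\<psi> (\<phi> v) = v" using \<phi>I by simp_all
  qed
  have \<phi>_add: "\<phi> (v \<oplus>\<^bsub>V\<^esub> w) = \<phi> v + \<phi> w" if "v \<in> carrier V" "w \<in> carrier V" for v w
    using \<phi>[OF that(1)] \<phi>[OF that(2)] by (intro \<phi>I) (auto simp: X_def \<psi>_add)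
  have \<phi>_scale: "\<phi> (c \<odot>\<^bsub>V\<^esub> v) = fun_scale c (\<phi> v)" if "v \<in> carrier V" for c v
    using \<phi>[OF that] by (intro \<phi>I) (auto simp: X_def \<psi>_scale)
  have \<phi>_zero: "\<phi> \<zero>\<^bsub>V\<^esub> = 0"
    using \<phi>_scale[OF V.M.zero_closed, of 0] by (simp add: fun_eq_iff)
  \<comment> \<open>\<open>\<psi>\<close> is linear on all functions, not only on \<open>X\<close>,
    so \<open>f\<close> is linear on the whole type.\<close>
  define f where "f x = \<phi> (A (\<psi> x))" for x
  interpret F: vector_space "fun_scale :: complex \<Rightarrow> ('v \<Rightarrow> complex) \<Rightarrow> 'v \<Rightarrow> complex"
    by (rule vector_space_fun_scale)
  have "coordinates fun_scale f V \<phi> A"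
  proof unfold_locales
    show "f (x + y) = f x + f y" "f (fun_scale c x) = fun_scale c (f x)" for x y c
      by (simp_all add: f_def \<psi>_add \<psi>_scale \<psi>_closed \<phi>_add \<phi>_scale)
    show "inj_on \<phi> (carrier V)" using \<phi>(2) by (metis inj_onI)
  qed (simp_all add: \<phi> f_def \<phi>_add \<phi>_scale \<phi>_zero)
  then show ?thesis by blast
qed

section \<open>The quotient by the kernel\<close>

text \<open>The coset of \<open>v\<close> gets the coordinates of \<open>A v\<close>. This is
  injective because cosets of the kernel are fibres of \<open>A\<close>, and it turns the induced
  map into \<open>f\<close> because both sides give the coordinates of
  \<open>A (A v)\<close>.\<close>

lemma coordinates_quotient:
  fixes V :: "(complex, 'v) module" and A :: "'v \<Rightarrow> 'v"
  assumes A: "linear_map class_ring V V A" and \<phi>: "coordinates scale f V \<phi> A"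
  defines "Q \<equiv> quotient_space V (mod_hom.ker V V A)"
  shows "coordinates scale f Q (\<phi> \<circ> factor_map A) (induced_map V A)"
    and "(\<phi> \<circ> factor_map A) ` carrier Q = f ` \<phi> ` carrier V"
proof -
  interpret \<phi>: coordinates scale f V \<phi> A by (rule \<phi>)
  interpret A: linear_map "class_ring :: complex ring" V V A by (rule A)
  define K where "K = mod_hom.ker V V A"
  define q where "q v = K +>\<^bsub>V\<^esub> v" for v
  have K: "K = {v \<in> carrier V. A v = \<zero>\<^bsub>V\<^esub>}" by (simp add: K_def A.ker_def)
  have carrier_Q: "carrier Q = q ` carrier V"
    by (auto simp: Q_def K_def[symmetric] quotient_space_def A_RCOSETS_def' q_def)
  \<comment> \<open>Cosets as fibres of \<open>A\<close>: the operations on the quotient are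
    computed from this description.\<close>
  have in_q: "x \<in> q v \<longleftrightarrow> x \<in> carrier V \<and> A x = A v" if v: "v \<in> carrier V" for x v
  proof
    assume "x \<in> q v"
    then show "x \<in> carrier V \<and> A x = A v" using v by (auto simp: q_def a_r_coset_def' K)
  next
    assume x: "x \<in> carrier V \<and> A x = A v"
    then have "x \<ominus>\<^bsub>V\<^esub> v \<in> K" using v by (simp add: K)
    moreover have "x = (x \<ominus>\<^bsub>V\<^esub> v) \<oplus>\<^bsub>V\<^esub> v"
      using x v by (simp add: a_minus_def \<phi>.W.M.a_assoc \<phi>.W.M.l_neg)
    ultimately show "x \<in> q v" by (auto simp: q_def a_r_coset_def')
  qed
  have q_eq: "q v = q w" if "v \<in> carrier V" "w \<in> carrier V" "A v = A w" for v w
    using that by (auto simp: in_q)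
  have factor: "factor_map A (q v) = A v" if v: "v \<in> carrier V" for v
  proof -
    have "A ` q v = {A v}" using in_q[OF v] v by auto
    then show ?thesis by (simp add: factor_map_def)
  qed
  have q_add: "q v \<oplus>\<^bsub>Q\<^esub> q w = q (v \<oplus>\<^bsub>V\<^esub> w)" if v: "v \<in> carrier V" and w: "w \<in> carrier V" for v w
  proof -
    have "x \<in> q v <+>\<^bsub>V\<^esub> q w" if x: "x \<in> carrier V" "A x = A (v \<oplus>\<^bsub>V\<^esub> w)" for x
    proof -
      have "x \<ominus>\<^bsub>V\<^esub> w \<in> q v" using x v w by (simp add: in_q a_minus_def \<phi>.W.M.a_assoc \<phi>.W.M.r_neg)
      moreover have "w \<in> q w" using w by (simp add: in_q)
      moreover have "x = (x \<ominus>\<^bsub>V\<^esub> w) \<oplus>\<^bsub>V\<^esub> w"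
        using x w by (simp add: a_minus_def \<phi>.W.M.a_assoc \<phi>.W.M.l_neg)
      ultimately show ?thesis unfolding set_add_def' by blast
    qed
    then have "q v <+>\<^bsub>V\<^esub> q w = q (v \<oplus>\<^bsub>V\<^esub> w)"
      using v w by (auto simp: in_q set_add_def')
    then show ?thesis by (simp add: Q_def quotient_space_def)
  qed
  have q_smult: "a \<odot>\<^bsub>Q\<^esub> q v = q (a \<odot>\<^bsub>V\<^esub> v)" if v: "v \<in> carrier V" for a v
  proof -
    \<comment> \<open>All cosets in the union defining scalar multiplication agree, so it
      collapses.\<close>
    have "q (a \<odot>\<^bsub>V\<^esub> x) = q (a \<odot>\<^bsub>V\<^esub> v)" if "x \<in> q v" for x
      using that v by (intro q_eq) (auto simp: in_q)
    moreover have "v \<in> q v" using v by (simp add: in_q)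
    ultimately have "(\<Union>x\<in>q v. q (a \<odot>\<^bsub>V\<^esub> x)) = q (a \<odot>\<^bsub>V\<^esub> v)" by blast
    then show ?thesis by (simp add: Q_def quotient_space_def K_def[symmetric] q_def)
  qed
  have q_zero: "\<zero>\<^bsub>Q\<^esub> = q \<zero>\<^bsub>V\<^esub>"
  proof -
    have "q \<zero>\<^bsub>V\<^esub> = K" by (auto simp: in_q K)
    then show ?thesis by (simp add: Q_def quotient_space_def K_def)
  qed
  have q_induced: "induced_map V A (q v) = q (A v)" if "v \<in> carrier V" for v
    using factor[OF that] by (simp add: induced_map_def quotient_map_def q_def K_def)
  show "coordinates scale f Q (\<phi> \<circ> factor_map A) (induced_map V A)"
  proof unfold_locales
    show "inj_on (\<phi> \<circ> factor_map A) (carrier Q)"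
    proof (rule inj_onI)
      fix x y assume "x \<in> carrier Q" "y \<in> carrier Q"
        and eq: "(\<phi> \<circ> factor_map A) x = (\<phi> \<circ> factor_map A) y"
      then obtain v w where vw: "v \<in> carrier V" "w \<in> carrier V" "x = q v" "y = q w"
        unfolding carrier_Q by blast
      then have "A v = A w" using eq by (simp add: factor \<phi>.\<phi>_eq_iff)
      from q_eq[OF vw(1,2) this] show "x = y" unfolding vw(3,4) .
    qed
  qed (auto simp: carrier_Q q_zero q_add q_smult q_induced factor \<phi>.\<phi>_simps)
  have "(\<phi> \<circ> factor_map A) ` carrier Q = (\<lambda>v. \<phi> (A v)) ` carrier V"
    unfolding carrier_Q image_image by (intro image_cong) (simp_all add: factor)
  then show "(\<phi> \<circ> factor_map A) ` carrier Q = f ` \<phi> ` carrier V"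
    unfolding image_image by (simp add: \<phi>.\<phi>_T cong: image_cong)
qed

section \<open>The correspondence of chains\<close>

text \<open>Truncated subtraction sends both 0 and 1 to 0; the filter removes both, so no counts are
  merged.\<close>

lemma count_filter_pred:
  "count (filter_mset (\<lambda>n. n \<noteq> 0) (image_mset (\<lambda>n. n - 1) M)) m =
     (if m = 0 then 0 else count M (Suc m))"
  by (induction M) auto

text \<open>For eigenvalue 0, \<open>J'\<close> has as many chains of length \<open>m > 0\<close> as
  \<open>J\<close> has of length \<open>m + 1\<close>. Hence lowering the length and keeping the
  index \<open>i\<close> is a bijection.\<close>

lemma chain_correspondence:
  fixes J J' :: jordan_structure
  assumes ev: "eigenvalues J = {l. chain_lengths J l \<noteq> {#}}"
    and ev': "eigenvalues J' = {l. chain_lengths J' l \<noteq> {#}}"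
    and nz: "\<And>l. l \<noteq> 0 \<Longrightarrow> chain_lengths J' l = chain_lengths J l"
    and z: "chain_lengths J' 0 =
      filter_mset (\<lambda>n. n \<noteq> 0) (image_mset (\<lambda>n. n - 1) (chain_lengths J 0))"
    and pos: "\<And>l. 0 \<notin># chain_lengths J l"
  shows "\<exists>p :: complex \<times> nat \<times> nat \<rightharpoonup> complex \<times> nat \<times> nat.
        dom p \<subseteq> chain_set J \<and> ran p = chain_set J' \<and>
        (\<forall>l n i. (l, n, i) \<in> chain_set J \<and> l \<noteq> 0 \<longrightarrow> p (l, n, i) = Some (l, n, i)) \<and>
        bij_betw (\<lambda>c. the (p c))
          {(l, n, i). (l, n, i) \<in> chain_set J \<and> l = 0 \<and> n \<noteq> 1}
          {(l, n, i). (l, n, i) \<in> chain_set J' \<and> l = 0} \<and>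
        (\<forall>n i m k. p (0, n, i) = Some (0, m, k) \<longrightarrow> n = m + 1) \<and>
        {c \<in> chain_set J. p c = None} =
          {(l, n, i). (l, n, i) \<in> chain_set J \<and> l = 0 \<and> n = 1}"
proof -
  have J: "(l, n, i) \<in> chain_set J \<longleftrightarrow> i < count (chain_lengths J l) n" for l n i
    by (auto simp: chain_set_def ev)
  have J': "(l, n, i) \<in> chain_set J' \<longleftrightarrow> i < count (chain_lengths J' l) n" for l n i
    by (auto simp: chain_set_def ev')
  have nz': "(l, n, i) \<in> chain_set J' \<longleftrightarrow> (l, n, i) \<in> chain_set J" if "l \<noteq> 0" for l n i
    using that by (simp add: J J' nz)
  have z': "(0, m, i) \<in> chain_set J' \<longleftrightarrow> m \<noteq> 0 \<and> (0, Suc m, i) \<in> chain_set J" for m i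
  proof -
    have "count (chain_lengths J' 0) m = (if m = 0 then 0 else count (chain_lengths J 0) (Suc m))"
      unfolding z by (rule count_filter_pred)
    then show ?thesis by (simp add: J J')
  qed
  \<comment> \<open>With length 0 excluded, \<open>n \<noteq> 1\<close> means at least 2, so
    \<open>n - 1\<close> below is a genuine, positive predecessor.\<close>
  have pos': "(l, 0, i) \<notin> chain_set J" for l i
    using pos[of l] by (simp add: J not_in_iff)
  define p :: "complex \<times> nat \<times> nat \<rightharpoonup> complex \<times> nat \<times> nat" where
    "p = (\<lambda>(l, n, i). if (l, n, i) \<notin> chain_set J then None
       else if l \<noteq> 0 then Some (l, n, i)
       else if n = 1 then None else Some (0, n - 1, i))"
  have ran: "ran p = chain_set J'"
  proof (intro subset_antisym subsetI)
    fix c assume "c \<in> ran p"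
    then obtain l n i where "p (l, n, i) = Some c" by (auto simp: ran_def)
    then show "c \<in> chain_set J'"
      using pos' by (cases n) (auto simp: p_def nz' z' split: if_splits)
  next
    fix c assume c: "c \<in> chain_set J'"
    obtain l n i where lni: "c = (l, n, i)" by (metis prod_cases3)
    show "c \<in> ran p"
    proof (cases "l = 0")
      case True
      then have "p (0, Suc n, i) = Some c" using c lni by (simp add: p_def z')
      then show ?thesis by (rule ranI)
    next
      case False
      then have "p c = Some c" using c lni by (simp add: p_def nz')
      then show ?thesis by (rule ranI)
    qed
  qed
  have bij: "bij_betw (\<lambda>c. the (p c))
      {(l, n, i). (l, n, i) \<in> chain_set J \<and> l = 0 \<and> n \<noteq> 1}
      {(l, n, i). (l, n, i) \<in> chain_set J' \<and> l = 0}"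
  proof (rule bij_betw_byWitness[where f' = "\<lambda>(l, n, i). (l, Suc n, i)"])
    show "\<forall>c\<in>{(l, n, i). (l, n, i) \<in> chain_set J \<and> l = 0 \<and> n \<noteq> 1}.
        (\<lambda>(l, n, i). (l, Suc n, i)) (the (p c)) = c"
    proof clarify
      fix n i assume c: "(0, n, i) \<in> chain_set J" "n \<noteq> 1"
      then have "n \<noteq> 0" using pos' by metis
      then show "(\<lambda>(l, n, i). (l, Suc n, i)) (the (p (0, n, i))) = (0, n, i)"
        using c by (simp add: p_def)
    qed
    show "\<forall>c\<in>{(l, n, i). (l, n, i) \<in> chain_set J' \<and> l = 0}.
        the (p ((\<lambda>(l, n, i). (l, Suc n, i)) c)) = c"
      by (auto simp: p_def z')
    show "(\<lambda>c. the (p c)) ` {(l, n, i). (l, n, i) \<in> chain_set J \<and> l = 0 \<and> n \<noteq> 1}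
        \<subseteq> {(l, n, i). (l, n, i) \<in> chain_set J' \<and> l = 0}"
    proof clarify
      fix l m k n i assume c: "(0, n, i) \<in> chain_set J" "n \<noteq> 1"
        and eq: "(l, m, k) = the (p (0, n, i))"
      have "n \<noteq> 0" using c pos' by metis
      with c eq show "(l, m, k) \<in> chain_set J' \<and> l = 0" by (simp add: p_def z')
    qed
    show "(\<lambda>(l, n, i). (l, Suc n, i)) ` {(l, n, i). (l, n, i) \<in> chain_set J' \<and> l = 0}
        \<subseteq> {(l, n, i). (l, n, i) \<in> chain_set J \<and> l = 0 \<and> n \<noteq> 1}"
      by (auto simp: z')
  qed
  have len: "n = m + 1" if eq: "p (0, n, i) = Some (0, m, k)" for n i m k
  proof -
    have "(0, n, i) \<in> chain_set J" using eq by (auto simp: p_def split: if_splits)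
    then have "n \<noteq> 0" using pos' by metis
    then show ?thesis using eq by (auto simp: p_def split: if_splits)
  qed
  have "dom p \<subseteq> chain_set J" by (auto simp: p_def split: if_splits)
  moreover have "\<forall>l n i. (l, n, i) \<in> chain_set J \<and> l \<noteq> 0 \<longrightarrow> p (l, n, i) = Some (l, n, i)"
    by (simp add: p_def)
  moreover have "{c \<in> chain_set J. p c = None} =
      {(l, n, i). (l, n, i) \<in> chain_set J \<and> l = 0 \<and> n = 1}"
    by (auto simp: p_def split: if_splits)
  moreover have "\<forall>n i m k. p (0, n, i) = Some (0, m, k) \<longrightarrow> n = m + 1" using len by blast
  ultimately show ?thesis using ran bij by (intro exI[of _ p] conjI)
qed

text \<open>The partial map \<open>p\<close> models the projection of chains; the chains where it is
  undefined are its kernel. The unique existence clauses ensure that \<open>J\<close> and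
  \<open>J'\<close>, defined by \<open>THE\<close>, are meaningful.\<close>

theorem theorem1:
  fixes V :: "(complex, 'v) module"
    and A :: "'v \<Rightarrow> 'v"
    and K :: "'v set"
    and J J' :: jordan_structure
  assumes "vectorspace class_ring V"
    and "vectorspace.fin_dim class_ring V"
    and "linear_map class_ring V V A"
    and "K = mod_hom.ker V V A"
    and "0 < vectorspace.dim class_ring (V\<lparr>carrier := K\<rparr>)"
    and "vectorspace.dim class_ring (V\<lparr>carrier := K\<rparr>) < vectorspace.dim class_ring V"
    and "J = jordan_structure_of V A"
    and "J' = jordan_structure_of (quotient_space V K) (induced_map V A)"
  shows
    "(\<exists>!S. is_jordan_structure V A S) \<and>
     (\<exists>!S. is_jordan_structure (quotient_space V K) (induced_map V A) S) \<and>
     eigenvalues J' - {0} = eigenvalues J - {0} \<and>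
     (\<forall>l. l \<noteq> 0 \<longrightarrow> chain_lengths J' l = chain_lengths J l) \<and>
     (\<exists>p :: complex \<times> nat \<times> nat \<rightharpoonup> complex \<times> nat \<times> nat.
        dom p \<subseteq> chain_set J \<and> ran p = chain_set J' \<and>
        (\<forall>l n i. (l, n, i) \<in> chain_set J \<and> l \<noteq> 0 \<longrightarrow> p (l, n, i) = Some (l, n, i)) \<and>
        bij_betw (\<lambda>c. the (p c))
          {(l, n, i). (l, n, i) \<in> chain_set J \<and> l = 0 \<and> n \<noteq> 1}
          {(l, n, i). (l, n, i) \<in> chain_set J' \<and> l = 0} \<and>
        (\<forall>n i m k. p (0, n, i) = Some (0, m, k) \<longrightarrow> n = m + 1) \<and>
        {c \<in> chain_set J. p c = None} =
          {(l, n, i). (l, n, i) \<in> chain_set J \<and> l = 0 \<and> n = 1})"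
proof -
  obtain f \<phi> where \<phi>: "coordinates fun_scale (f :: ('v \<Rightarrow> complex) \<Rightarrow> 'v \<Rightarrow> complex) V \<phi> A"
    using ex_coordinates[OF assms(1-3)] by blast
  interpret V: coordinates fun_scale f V \<phi> A by (rule \<phi>)
  let ?Q = "quotient_space V K" and ?T = "induced_map V A"
  \<comment> \<open>Same coordinate space and same \<open>f\<close> as for \<open>V\<close>: both
    structures can be read off chains of one endomorphism.\<close>
  interpret Q: coordinates fun_scale f ?Q "\<phi> \<circ> factor_map A" ?T
    unfolding assms(4) by (rule coordinates_quotient(1)[OF assms(3) \<phi>])
  have Q_image: "(\<phi> \<circ> factor_map A) ` carrier ?Q = f ` \<phi> ` carrier V"
    unfolding assms(4) by (rule coordinates_quotient(2)[OF assms(3) \<phi>])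
  obtain \<beta> where \<beta>: "finite \<beta>" "V.W.basis \<beta>" using V.W.finite_basis_exists[OF assms(2)] by blast
  have "f ` \<phi> ` carrier V \<subseteq> \<phi> ` carrier V"
    using V.T_closed by (auto simp flip: V.\<phi>_T)
  then obtain cs where cs: "V.chains_basis (\<phi> ` carrier V) cs"
    using V.chains_basis_exists[of "\<phi> ` \<beta>"] V.basis_iff[OF \<beta>(1)] \<beta> by (auto simp: V.W.basis_def)
  \<comment> \<open>As \<open>shift 0\<close> is \<open>f\<close>, shortening at 0 gives a Jordan
    basis of exactly the subspace representing the quotient.\<close>
  have cs': "V.chains_basis ((\<phi> \<circ> factor_map A) ` carrier ?Q) (V.shorten 0 cs)"
    using V.chains_basis_shorten[OF cs, of 0] unfolding Q_image V.shift_0 .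
  have J: "J = V.structure_of_chains cs"
    using V.jordan_structure_of_eq(2)[OF cs] assms(7) by simp
  have J': "J' = V.structure_of_chains (V.shorten 0 cs)"
    using Q.jordan_structure_of_eq(2)[OF cs'] assms(8) by simp
  have nz: "chain_lengths J' l = chain_lengths J l" if "l \<noteq> 0" for l
    using V.lengths_shorten_other[OF cs that] by (simp add: J J' V.structure_of_chains_def)
  have ev: "eigenvalues J = {l. chain_lengths J l \<noteq> {#}}"
    and ev': "eigenvalues J' = {l. chain_lengths J' l \<noteq> {#}}"
    by (simp_all add: J J' V.structure_of_chains_def)
  have z: "chain_lengths J' 0 =
      filter_mset (\<lambda>n. n \<noteq> 0) (image_mset (\<lambda>n. n - 1) (chain_lengths J 0))"
    using V.lengths_shorten[of 0 0 cs] by (simp add: J J' V.structure_of_chains_def)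
  have pos: "0 \<notin># chain_lengths J l" for l
    using V.zero_notin_lengths[OF cs] by (simp add: J V.structure_of_chains_def)
  have "eigenvalues J' - {0} = eigenvalues J - {0}" using nz by (auto simp: ev ev')
  then show ?thesis
    using V.jordan_structure_of_eq(1)[OF cs] Q.jordan_structure_of_eq(1)[OF cs'] nz
      chain_correspondence[OF ev ev' nz z pos]
    by (intro conjI allI impI)
qed

end
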